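(* For each natural number $n\ge 1$ there exists a smooth immersion $f_n:\mathbb{S}^1\to\mathbb{R}^2$ with $\mathrm{arc}(f_n)=3$, whose multiple points are only finitely many transversal double points, such that the associated chord diagram $\mathcal{C}(f_n)$ of $f_n$ has a sub-chord diagram which is equivalent to $\mathcal{C}_{2n+1}$ but has no sub-chord diagram which is equivalent to $\mathcal{C}_{2m+1}$ for any natural number $m$ with $1\le m<n$.
   Context: Natural numbers are positive integers. $\mathbb{S}^1$ is the unit circle in $\mathbb{R}^2$. Arc number of a map: Let $X$ be a set and $f:\mathbb{S}^1\to X$ a map. For a natural number $n>1$, $f$ can be divided into $n$ arc embeddings if there are $n$ subspaces $I_1,\dots,I_n$ of $\mathbb{S}^1$, each homeomorphic to a closed interval, with $\mathbb{S}^1=I_1\cup\cdots\cup I_n$ and $f|_{I_i}$ injective for each $i$. If $f$ is injective then $\mathrm{arc}(f)=1$; otherwise $\mathrm{arc}(f)$ is the smallest such $n$, and $\mathrm{arc}(f)=\infty$ if no such $n$ exists. Chord diagrams: For a natural number $m\ge 1$, an $m$-chord diagram on $\mathbb{S}^1$ is a pair $\mathcal{C}=(P,\varphi)$ where $P\subset\mathbb{S}^1$ contains exactly $2m$ points and $\varphi$ is a fixed point free involution on $P$. A chord of $\mathcal{C}$ is an unordered pair $(x,\varphi(x))=(\varphi(x),x)$ with $x\in P$. Two $m$-chord diagrams $(P_1,\varphi_1)$ and $(P_2,\varphi_2)$ are equivalent if there is an orientation preserving self-homeomorphism $h$ of $\mathbb{S}^1$ with $h(P_1)=P_2$ and $h\circ\varphi_1=\varphi_2\circ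 h$ on $P_1$. A chord diagram $(Q,\psi)$ is a sub-chord diagram of $(P,\varphi)$ if $Q\subset P$ and $\psi$ is the restriction of $\varphi$ to $Q$. Associated chord diagram: Let $f:\mathbb{S}^1\to X$ be a map whose multiple points are only finitely many double points, i.e. $S(f)=\{x\in\mathbb{S}^1 : f^{-1}(f(x))\text{ is not a singleton}\}$ is finite and $|f^{-1}(y)|\le 2$ for all $y\in X$. Then $\mathcal{C}(f)=(S(f),\varphi_f)$, where $\varphi_f:S(f)\to S(f)$ is the fixed point free involution with $f|_{S(f)}\circ\varphi_f=f|_{S(f)}$. The chord diagram $\mathcal{C}_{2n+1}$ ($n\ge 1$): For $k>2$ let $v_{k;1},\dots,v_{k;k}$ be the vertices of a regular $k$-gon inscribed in $\mathbb{S}^1$, in counterclockwise order, indices modulo $k$. For a natural number $j<k/2$, let $c(k;i,j)$ be the chord joining $v_{k;i}$ and $v_{k;i+j}$. Then $\mathcal{C}_{2n+1}$ is the $(2n+1)$-chord diagram whose chords are $c(4n+2;2i-1,2n-1)$ for $i\in\{1,\dots,2n+1\}$, i.e. the chords joining $v_{4n+2;2i-1}$ and $v_{4n+2;2i+2n-2}$. *)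

theory Defs
  imports "HOL-Analysis.Analysis"
begin

text \<open>
  The plane is modelled by the type \<^typ>\<open>complex\<close>, regarded as a real Euclidean space of dimension 2.
  A map defined on the unit circle is a total function of which only the values on the circle are
  used; likewise the involution of a chord diagram is only used on its set of endpoints.
\<close>

abbreviation S1 :: "complex set" where
  "S1 \<equiv> sphere 0 1"

definition divisible_into_arcs :: "(complex \<Rightarrow> 'b) \<Rightarrow> nat \<Rightarrow> bool" where
  "divisible_into_arcs f n \<longleftrightarrow>
     (\<exists>I :: nat \<Rightarrow> complex set.
        (\<forall>i\<in>{1..n}. I i homeomorphic {0..1::real} \<and> inj_on f (I i)) \<and>
        S1 = (\<Union>i\<in>{1..n}. I i))"

definition arc_number :: "(complex \<Rightarrow> 'b) \<Rightarrow> enat" where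
  "arc_number f =
     (if inj_on f S1 then 1
      else if \<exists>n>1. divisible_into_arcs f n
        then enat (LEAST n. n > 1 \<and> divisible_into_arcs f n)
      else \<infinity>)"

type_synonym chord_diag = "complex set \<times> (complex \<Rightarrow> complex)"

definition chord_diagram :: "nat \<Rightarrow> chord_diag \<Rightarrow> bool" where
  "chord_diagram m = (\<lambda>(P, \<phi>).
     m \<ge> 1 \<and> P \<subseteq> S1 \<and> finite P \<and> card P = 2 * m \<and>
     (\<forall>x\<in>P. \<phi> x \<in> P \<and> \<phi> x \<noteq> x \<and> \<phi> (\<phi> x) = x))"

text \<open>
  A self-homeomorphism of the circle preserves orientation if it lifts to an increasing map of the
  universal cover \<open>t \<mapsto> cis t\<close>.
\<close>

definition orientation_preserving_homeo :: "(complex \<Rightarrow> complex) \<Rightarrow> bool" where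
  "orientation_preserving_homeo h \<longleftrightarrow>
     (\<exists>g. homeomorphism S1 S1 h g) \<and>
     (\<exists>H :: real \<Rightarrow> real. continuous_on UNIV H \<and> strict_mono H \<and> (\<forall>t. h (cis t) = cis (H t)))"

definition equivalent_diagrams :: "chord_diag \<Rightarrow> chord_diag \<Rightarrow> bool" where
  "equivalent_diagrams = (\<lambda>(P\<^sub>1, \<phi>\<^sub>1) (P\<^sub>2, \<phi>\<^sub>2).
     \<exists>h. orientation_preserving_homeo h \<and> h ` P\<^sub>1 = P\<^sub>2 \<and> (\<forall>x\<in>P\<^sub>1. h (\<phi>\<^sub>1 x) = \<phi>\<^sub>2 (h x)))"

definition sub_chord_diagram :: "chord_diag \<Rightarrow> chord_diag \<Rightarrow> bool" where
  "sub_chord_diagram = (\<lambda>(Q, \<psi>) (P, \<phi>).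
     (\<exists>m. chord_diagram m (Q, \<psi>)) \<and> Q \<subseteq> P \<and> (\<forall>x\<in>Q. \<psi> x = \<phi> x))"

definition has_sub_equivalent_to :: "chord_diag \<Rightarrow> chord_diag \<Rightarrow> bool" where
  "has_sub_equivalent_to C D \<longleftrightarrow> (\<exists>E. sub_chord_diagram E C \<and> equivalent_diagrams E D)"

definition fiber :: "(complex \<Rightarrow> 'b) \<Rightarrow> 'b \<Rightarrow> complex set" where
  "fiber f y = {x \<in> S1. f x = y}"

definition multiple_points :: "(complex \<Rightarrow> 'b) \<Rightarrow> complex set" where
  "multiple_points f = {x \<in> S1. \<not> is_singleton (fiber f (f x))}"

definition finitely_many_double_points :: "(complex \<Rightarrow> 'b) \<Rightarrow> bool" where
  "finitely_many_double_points f \<longleftrightarrow>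
     finite (multiple_points f) \<and> (\<forall>y. finite (fiber f y) \<and> card (fiber f y) \<le> 2)"

text \<open>The definite description below denotes a unique point only if \<open>f\<close> has at most double points.\<close>

definition associated_diagram :: "(complex \<Rightarrow> 'b) \<Rightarrow> chord_diag" where
  "associated_diagram f =
     (multiple_points f, \<lambda>x. THE y. y \<in> multiple_points f \<and> y \<noteq> x \<and> f y = f x)"

text \<open>Periodicity of \<^const>\<open>cis\<close> makes the index \<open>i\<close> below range modulo \<open>k\<close>.\<close>

definition polygon_vertex :: "nat \<Rightarrow> nat \<Rightarrow> complex" where
  "polygon_vertex k i = cis (2 * pi * real i / real k)"

definition polygon_chord :: "nat \<Rightarrow> nat \<Rightarrow> nat \<Rightarrow> complex set" where
  "polygon_chord k i j = {polygon_vertex k i, polygon_vertex k (i + j)}"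

text \<open>The chord diagram with a given set of pairwise disjoint two-element sets as its chords.\<close>

definition diagram_of_chords :: "complex set set \<Rightarrow> chord_diag" where
  "diagram_of_chords K = (\<Union>K, \<lambda>x. THE y. {x, y} \<in> K)"

text \<open>The argument \<open>n\<close> gives the diagram \<open>C\<^sub>2\<^sub>n\<^sub>+\<^sub>1\<close> with \<open>2 * n + 1\<close> chords.\<close>

definition odd_polygon_diagram :: "nat \<Rightarrow> chord_diag" where
  "odd_polygon_diagram n =
     diagram_of_chords ((\<lambda>i. polygon_chord (4 * n + 2) (2 * i - 1) (2 * n - 1)) ` {1..2 * n + 1})"

text \<open>
  Smoothness, tangent vectors and transversality of a map of the circle are expressed in the
  local coordinate \<open>t \<mapsto> cis t\<close>, which is a local diffeomorphism onto the circle.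
\<close>

definition smooth_curve :: "(real \<Rightarrow> complex) \<Rightarrow> bool" where
  "smooth_curve g \<longleftrightarrow>
     (\<forall>k t. ((\<lambda>u s. vector_derivative u (at s)) ^^ k) g differentiable (at t))"

definition tangent_at :: "(complex \<Rightarrow> complex) \<Rightarrow> real \<Rightarrow> complex" where
  "tangent_at f t = vector_derivative (\<lambda>s. f (cis s)) (at t)"

definition smooth_immersion :: "(complex \<Rightarrow> complex) \<Rightarrow> bool" where
  "smooth_immersion f \<longleftrightarrow> smooth_curve (\<lambda>t. f (cis t)) \<and> (\<forall>t. tangent_at f t \<noteq> 0)"

definition transversal_multiple_points :: "(complex \<Rightarrow> complex) \<Rightarrow> bool" where
  "transversal_multiple_points f \<longleftrightarrow>
     (\<forall>s t. cis s \<noteq> cis t \<and> f (cis s) = f (cis t) \<longrightarrow>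
        span {tangent_at f s, tangent_at f t} = UNIV)"

end

(*
  Write d = 2n + 1 and wind a closed curve twice around the origin with d-fold rotational symmetry.
  In logarithmic polar coordinates it unrolls to a regular curve in the plane, the same for all n,
  that is invariant under a translation by 2T and has no self-intersections.  Two parameters give a
  double point of the closed curve iff their images on the unrolled curve differ by an odd multiple
  of dT, which, d being odd, is a crossing of the unrolled curve with its translate by T.  Three
  parameters cannot differ pairwise by odd multiples, so there are no triple points.

  Cut the parameter circle into d blocks, one per period.  All crossings with the translate by T
  stay within a block or between neighbouring blocks, so every chord of the closed curve advances by
  n or n + 1 blocks.  Hence n blocks form an embedded arc, and three arcs suffice.  In a copy of
  C_{2m+1} there are 2m + 1 successive disjoint chord arcs that wind m times around the circle, so
  (2m+1) n <= m (2n+1), i.e. n <= m.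

  The unrolled curve is a zigzag with four corners per period, so tuned that one crossing with the
  translate by T occurs at parameters exactly half a period apart and in the wrong order: the curve
  runs ahead of its translate and then turns back to be crossed.  Under the d-fold
  rotation these two parameters sweep out a regular (4n+2)-gon whose chords are those of C_{2n+1}.  This excludes two
  arcs: one of them would contain 2n + 1 consecutive vertices and thus a chord.
*)

theory Submission
  imports Defs
begin

subsection \<open>Smooth functions of a real variable\<close>

text \<open>Asking only for some derivative function at each stage makes every closure property
  below an induction on \<open>k\<close> fed by one derivative rule. \<open>smooth_curveI\<close>
  returns to iterated \<open>vector_derivative\<close>.\<close>

primrec times_differentiable :: "nat \<Rightarrow> (real \<Rightarrow> 'a::real_normed_vector) \<Rightarrow> bool" where
  "times_differentiable 0 g \<longleftrightarrow> True"
| "times_differentiable (Suc k) g \<longleftrightarrow>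
     (\<exists>g'. (\<forall>t. (g has_vector_derivative g' t) (at t)) \<and> times_differentiable k g')"

definition smooth_fun :: "(real \<Rightarrow> 'a::real_normed_vector) \<Rightarrow> bool" where
  "smooth_fun g \<longleftrightarrow> (\<forall>k. times_differentiable k g)"

lemma times_differentiable_SucI:
  "(\<And>t. (g has_vector_derivative g' t) (at t)) \<Longrightarrow> times_differentiable k g' \<Longrightarrow>
     times_differentiable (Suc k) g"
  by auto

lemma times_differentiable_decr:
  "times_differentiable (Suc k) g \<Longrightarrow> times_differentiable k g"
proof (induction k arbitrary: g)
  case (Suc k)
  then obtain g' where "\<forall>t. (g has_vector_derivative g' t) (at t)" "times_differentiable (Suc k) g'"
    by auto
  then show ?case using Suc.IH by auto
qed simp

lemma times_differentiable_const: "times_differentiable k (\<lambda>t. c)"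
proof (induction k arbitrary: c)
  case (Suc k)
  show ?case
    by (rule times_differentiable_SucI[where g' = "\<lambda>t. 0"]) (auto intro: Suc derivative_eq_intros)
qed simp

lemma times_differentiable_add:
  "times_differentiable k f \<Longrightarrow> times_differentiable k g \<Longrightarrow> times_differentiable k (\<lambda>t. f t + g t)"
proof (induction k arbitrary: f g)
  case (Suc k)
  from Suc.prems obtain f' g' where
    "\<forall>t. (f has_vector_derivative f' t) (at t)" "times_differentiable k f'"
    "\<forall>t. (g has_vector_derivative g' t) (at t)" "times_differentiable k g'"
    by auto
  then show ?case
    by (intro times_differentiable_SucI[where g' = "\<lambda>t. f' t + g' t"])
       (auto intro: Suc.IH has_vector_derivative_add)
qed simp

text \<open>The product rule keeps \<open>f\<close> and \<open>g\<close> themselves as factors, so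
  both are first weakened by \<open>times_differentiable_decr\<close>.\<close>

lemma times_differentiable_mult:
  fixes f g :: "real \<Rightarrow> 'a::real_normed_algebra"
  shows "times_differentiable k f \<Longrightarrow> times_differentiable k g \<Longrightarrow>
    times_differentiable k (\<lambda>t. f t * g t)"
proof (induction k arbitrary: f g)
  case (Suc k)
  from Suc.prems obtain f' g' where
    "\<forall>t. (f has_vector_derivative f' t) (at t)" "times_differentiable k f'"
    "\<forall>t. (g has_vector_derivative g' t) (at t)" "times_differentiable k g'"
    by auto
  moreover have "times_differentiable k f" "times_differentiable k g"
    using Suc.prems times_differentiable_decr by blast+
  ultimately show ?case
    by (intro times_differentiable_SucI[where g' = "\<lambda>t. f t * g' t + f' t * g t"])
       (auto intro: Suc.IH times_differentiable_add has_vector_derivative_mult)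
qed simp

lemma times_differentiable_bounded_linear:
  assumes "bounded_linear L"
  shows "times_differentiable k f \<Longrightarrow> times_differentiable k (\<lambda>t. L (f t))"
proof (induction k arbitrary: f)
  case (Suc k)
  from Suc.prems obtain f' where
    "\<forall>t. (f has_vector_derivative f' t) (at t)" "times_differentiable k f'"
    by auto
  then show ?case
    by (intro times_differentiable_SucI[where g' = "\<lambda>t. L (f' t)"])
       (auto intro: Suc.IH bounded_linear.has_vector_derivative[OF assms])
qed simp

lemma times_differentiable_affine:
  "times_differentiable k f \<Longrightarrow> times_differentiable k (\<lambda>t. f (a * t + b))"
proof (induction k arbitrary: f)
  case (Suc k)
  from Suc.prems obtain f' where f':
    "\<forall>t. (f has_vector_derivative f' t) (at t)" "times_differentiable k f'"
    by auto
  show ?case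
  proof (rule times_differentiable_SucI)
    have "((\<lambda>t. a * t + b) has_vector_derivative a) (at t)" for t
      unfolding has_real_derivative_iff_has_vector_derivative[symmetric]
      by (auto intro!: derivative_eq_intros)
    then show "((\<lambda>t. f (a * t + b)) has_vector_derivative a *\<^sub>R f' (a * t + b)) (at t)" for t
      using vector_diff_chain_at[of "\<lambda>t. a * t + b" a t f "f' (a * t + b)"] f'(1)
      by (auto simp: o_def)
    show "times_differentiable k (\<lambda>t. a *\<^sub>R f' (a * t + b))"
      using f'(2) by (intro times_differentiable_bounded_linear[OF bounded_linear_scaleR_right] Suc.IH)
  qed
qed simp

lemma times_differentiable_inverse:
  fixes f :: "real \<Rightarrow> real"
  assumes nz: "\<And>t. f t \<noteq> 0"
  shows "times_differentiable k f \<Longrightarrow> times_differentiable k (\<lambda>t. inverse (f t))"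
proof (induction k)
  case (Suc k)
  from Suc.prems obtain f' where f':
    "\<forall>t. (f has_vector_derivative f' t) (at t)" "times_differentiable k f'"
    by auto
  have inv: "times_differentiable k (\<lambda>t. inverse (f t))"
    using Suc times_differentiable_decr by blast
  show ?case
  proof (rule times_differentiable_SucI)
    \<comment> \<open>Written as a product of \<open>f'\<close> with copies of
      \<open>inverse (f t)\<close>, the derivative is covered by the induction hypothesis.\<close>
    show "((\<lambda>t. inverse (f t)) has_vector_derivative (-1) * (inverse (f t) * (f' t * inverse (f t)))) (at t)"
      for t
      using f'(1) nz unfolding has_real_derivative_iff_has_vector_derivative[symmetric]
      by (auto intro!: derivative_eq_intros)
    show "times_differentiable k (\<lambda>t. (-1) * (inverse (f t) * (f' t * inverse (f t))))"
      using inv f'(2) by (intro times_differentiable_mult times_differentiable_const)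
  qed
qed simp

lemma times_differentiable_exp:
  fixes f :: "real \<Rightarrow> complex"
  shows "times_differentiable k f \<Longrightarrow> times_differentiable k (\<lambda>t. exp (f t))"
proof (induction k)
  case (Suc k)
  from Suc.prems obtain f' where f':
    "\<forall>t. (f has_vector_derivative f' t) (at t)" "times_differentiable k f'"
    by auto
  have e: "times_differentiable k (\<lambda>t. exp (f t))"
    using Suc times_differentiable_decr by blast
  show ?case
  proof (rule times_differentiable_SucI)
    show "((\<lambda>t. exp (f t)) has_vector_derivative f' t * exp (f t)) (at t)" for t
      using field_vector_diff_chain_at[of f "f' t" t exp "exp (f t)"] f'(1)
      by (auto simp: o_def)
    show "times_differentiable k (\<lambda>t. f' t * exp (f t))"
      using e f'(2) by (intro times_differentiable_mult)
  qed
qed simp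

text \<open>Agreement on an open set passes to the derivatives there, so the induction can continue
  with \<open>vector_derivative g\<close>. This serves a curve glued from translated pieces.\<close>

lemma times_differentiable_local:
  "(\<And>t. \<exists>U h. open U \<and> t \<in> U \<and> times_differentiable k h \<and> (\<forall>s\<in>U. g s = h s)) \<Longrightarrow>
     times_differentiable k g"
proof (induction k arbitrary: g)
  case (Suc k)
  have *: "\<exists>U h. open U \<and> t \<in> U \<and> times_differentiable k h \<and>
    (\<forall>s\<in>U. (g has_vector_derivative h s) (at s))" for t
  proof -
    from Suc.prems obtain U h h' where U: "open U" "t \<in> U" "\<forall>s\<in>U. g s = h s"
      and h: "\<forall>t. (h has_vector_derivative h' t) (at t)" "times_differentiable k h'"
      by (metis times_differentiable.simps(2))
    have "(g has_vector_derivative h' s) (at s)" if "s \<in> U" for s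
      using h(1) U that by (metis has_vector_derivative_transform_within_open)
    then show ?thesis using U h by blast
  qed
  show ?case
  proof (rule times_differentiable_SucI)
    show "(g has_vector_derivative vector_derivative g (at t)) (at t)" for t
      using * by (metis vector_derivative_works differentiableI_vector)
    show "times_differentiable k (\<lambda>t. vector_derivative g (at t))"
    proof (rule Suc.IH)
      fix t
      obtain U h where "open U" "t \<in> U" "times_differentiable k h"
        "\<forall>s\<in>U. (g has_vector_derivative h s) (at s)" using * by blast
      then show "\<exists>U h. open U \<and> t \<in> U \<and> times_differentiable k h \<and> (\<forall>s\<in>U. vector_derivative g (at s) = h s)"
        by (metis vector_derivative_at)
    qed
  qed
qed simp

lemma smooth_fun_localI:
  assumes "\<And>t. \<exists>U h. open U \<and> t \<in> U \<and> smooth_fun h \<and> (\<forall>s\<in>U. g s = h s)"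
  shows "smooth_fun g"
  unfolding smooth_fun_def
  by (intro allI times_differentiable_local) (meson assms smooth_fun_def)

lemma smooth_fun_intros:
  shows smooth_fun_const: "smooth_fun (\<lambda>t. c)"
    and smooth_fun_add: "smooth_fun f \<Longrightarrow> smooth_fun g \<Longrightarrow> smooth_fun (\<lambda>t. f t + g t)"
    and smooth_fun_mult: "smooth_fun (u :: real \<Rightarrow> 'b::real_normed_algebra) \<Longrightarrow> smooth_fun v \<Longrightarrow>
      smooth_fun (\<lambda>t. u t * v t)"
    and smooth_fun_affine: "smooth_fun f \<Longrightarrow> smooth_fun (\<lambda>t. f (a * t + b))"
    and smooth_fun_exp: "smooth_fun w \<Longrightarrow> smooth_fun (\<lambda>t. exp (w t :: complex))"
  unfolding smooth_fun_def
  by (auto intro: times_differentiable_const times_differentiable_add times_differentiable_mult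
      times_differentiable_affine times_differentiable_exp)

lemma smooth_fun_of_real:
  "smooth_fun f \<Longrightarrow> smooth_fun (\<lambda>t. of_real (f t) :: 'b::{real_normed_algebra_1})"
  unfolding smooth_fun_def
  by (auto intro: times_differentiable_bounded_linear[OF bounded_linear_of_real])

lemma smooth_fun_id: "smooth_fun (\<lambda>t::real. t)"
  unfolding smooth_fun_def
proof
  show "times_differentiable k (\<lambda>t::real. t)" for k
    by (cases k) (auto intro!: exI[of _ "\<lambda>t. 1"] times_differentiable_const derivative_eq_intros)
qed

lemma smooth_fun_inverse:
  "smooth_fun f \<Longrightarrow> (\<And>t. f t \<noteq> 0) \<Longrightarrow> smooth_fun (\<lambda>t. inverse (f t :: real))"
  unfolding smooth_fun_def by (auto intro: times_differentiable_inverse)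

lemma smooth_curveI:
  assumes "smooth_fun g"
  shows "smooth_curve g"
proof -
  have "((\<lambda>u s. vector_derivative u (at s)) ^^ k) g differentiable (at t)"
    if "times_differentiable (Suc k) g" for k t
    using that
  proof (induction k arbitrary: g)
    case 0
    then show ?case by (auto intro: differentiableI_vector)
  next
    case (Suc k)
    then obtain g' where g': "\<forall>t. (g has_vector_derivative g' t) (at t)"
      and "times_differentiable (Suc k) g'" by (meson times_differentiable.simps(2))
    moreover have "(\<lambda>s. vector_derivative g (at s)) = g'"
      using g' vector_derivative_at by blast
    ultimately show ?case
      using Suc.IH[of g'] by (simp add: funpow_Suc_right del: funpow.simps)
  qed
  then show ?thesis
    using assms unfolding smooth_curve_def smooth_fun_def by blast
qed

section \<open>Functions that are flat at the origin\<close>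

definition flat_exp :: "real poly \<Rightarrow> real \<Rightarrow> real" where
  "flat_exp p x = (if x > 0 then poly p (1 / x) * exp (- (1 / x)) else 0)"

lemma poly_mult_exp_tendsto_0: "((\<lambda>y. poly p y * exp (- y)) \<longlongrightarrow> (0::real)) at_top"
proof -
  have "((\<lambda>y::real. \<Sum>i\<le>degree p. coeff p i * (y ^ i / exp y)) \<longlongrightarrow> (\<Sum>i\<le>degree p. coeff p i * 0)) at_top"
    by (intro tendsto_sum tendsto_mult tendsto_const tendsto_power_div_exp_0)
  then show ?thesis
    by (simp add: poly_altdef sum_distrib_right exp_minus divide_inverse mult.assoc)
qed

lemma flat_exp_tendsto_0: "(flat_exp p \<longlongrightarrow> 0) (at 0)"
proof (rule filterlim_split_at)
  have "((\<lambda>x. 0::real) \<longlongrightarrow> 0) (at_left 0)" by simp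
  then show "(flat_exp p \<longlongrightarrow> 0) (at_left 0)"
    by (rule tendsto_cong[THEN iffD1, rotated])
       (auto simp: eventually_at_left_field flat_exp_def intro!: exI[of _ "-1"])
  have "(((\<lambda>y. poly p y * exp (- y)) \<circ> inverse) \<longlongrightarrow> (0::real)) (at_right 0)"
    unfolding o_def by (rule filterlim_compose[OF poly_mult_exp_tendsto_0 filterlim_inverse_at_top_right])
  then show "(flat_exp p \<longlongrightarrow> 0) (at_right 0)"
    by (rule tendsto_cong[THEN iffD1, rotated])
       (auto simp: eventually_at_right_field flat_exp_def inverse_eq_divide intro!: exI[of _ "1"])
qed

text \<open>With the polynomial as a parameter the family p(1/x) exp(-1/x) is closed under
  differentiation, so a single induction shows that all its members are smooth.\<close>

lemma flat_exp_derivative: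
  "(flat_exp p has_real_derivative flat_exp ([:0,0,1:] * (p - pderiv p)) x) (at x)"
proof -
  consider "x < 0" | "x > 0" | "x = 0" by linarith
  then show ?thesis
  proof cases
    case 1
    have "((\<lambda>x. 0) has_real_derivative 0) (at x)" by simp
    then have "(flat_exp p has_real_derivative 0) (at x)"
      by (rule has_field_derivative_transform_within_open[where S = "{..<0}"])
         (use 1 in \<open>auto simp: flat_exp_def\<close>)
    then show ?thesis using 1 by (simp add: flat_exp_def)
  next
    case 2
    have "((\<lambda>x. poly p (1 / x) * exp (- (1 / x))) has_real_derivative
        flat_exp ([:0,0,1:] * (p - pderiv p)) x) (at x)"
      using 2 by (auto intro!: derivative_eq_intros DERIV_chain2[OF poly_DERIV] simp: flat_exp_def)
         (simp add: field_simps power2_eq_square)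
    then show ?thesis
      by (rule has_field_derivative_transform_within_open[where S = "{0<..}"])
         (use 2 in \<open>auto simp: flat_exp_def\<close>)
  next
    case 3
    \<comment> \<open>For nonzero \<open>h\<close> this difference quotient is
      \<open>flat_exp (pCons 0 p) h\<close>: the factor 1/h is absorbed into the polynomial.\<close>
    have "((\<lambda>h. (flat_exp p (0 + h) - flat_exp p 0) / h) \<longlongrightarrow> 0) (at 0)"
      using flat_exp_tendsto_0[of "pCons 0 p"]
      by (rule tendsto_cong[THEN iffD1, rotated])
         (auto simp: eventually_at flat_exp_def intro!: exI[of _ 1])
    then show ?thesis
      using 3 by (simp add: DERIV_def flat_exp_def)
  qed
qed

lemma smooth_fun_flat_exp: "smooth_fun (flat_exp p)"
  unfolding smooth_fun_def
proof
  show "times_differentiable k (flat_exp p)" for k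
  proof (induction k arbitrary: p)
    case (Suc k)
    then show ?case
      using flat_exp_derivative by (auto simp: has_real_derivative_iff_has_vector_derivative)
  qed simp
qed

subsection \<open>The combinatorics of the zigzag\<close>

text \<open>
  One period of the zigzag has the corners \<open>(-144, 0)\<close>, \<open>(72, 252)\<close>, \<open>(144, 180)\<close>, \<open>(72, 216)\<close>, \<open>(0, 0)\<close>,
  reached at the times \<open>-13\<close>, \<open>-7\<close>, \<open>1\<close>, \<open>19\<close>, \<open>27\<close>; so \<open>T = 72\<close>, and time 40 advances by \<open>2 T = 144\<close>.
  The relation over-approximates the smoothed zigzag: close to a corner it only records the
  contributions \<open>a\<close> and \<open>b\<close> of the two adjacent edges to the elapsed time.
\<close>

inductive on_piece :: "real \<Rightarrow> real \<Rightarrow> real \<Rightarrow> bool" where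
  "-1/4 \<le> a \<Longrightarrow> a \<le> 1/4 \<Longrightarrow> -1/4 \<le> b \<Longrightarrow> b \<le> 1/4 \<Longrightarrow>
     on_piece (-13 + a + b) (-144 - 9 * a + 36 * b) (-27 * a + 42 * b)"
| "1/4 \<le> s \<Longrightarrow> s \<le> 23/4 \<Longrightarrow>
     on_piece (-13 + s) (-144 + 36 * s) (42 * s)"
| "-1/4 \<le> a \<Longrightarrow> a \<le> 1/4 \<Longrightarrow> -1/4 \<le> b \<Longrightarrow> b \<le> 1/4 \<Longrightarrow>
     on_piece (-7 + a + b) (72 + 36 * a + 9 * b) (252 + 42 * a - 9 * b)"
| "1/4 \<le> s \<Longrightarrow> s \<le> 31/4 \<Longrightarrow>
     on_piece (-7 + s) (72 + 9 * s) (252 - 9 * s)"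
| "-1/4 \<le> a \<Longrightarrow> a \<le> 1/4 \<Longrightarrow> -1/4 \<le> b \<Longrightarrow> b \<le> 1/4 \<Longrightarrow>
     on_piece (1 + a + b) (144 + 9 * a - 4 * b) (180 - 9 * a + 2 * b)"
| "1/4 \<le> s \<Longrightarrow> s \<le> 71/4 \<Longrightarrow>
     on_piece (1 + s) (144 - 4 * s) (180 + 2 * s)"
| "-1/4 \<le> a \<Longrightarrow> a \<le> 1/4 \<Longrightarrow> -1/4 \<le> b \<Longrightarrow> b \<le> 1/4 \<Longrightarrow>
     on_piece (19 + a + b) (72 - 4 * a - 9 * b) (216 + 2 * a - 27 * b)"
| "1/4 \<le> s \<Longrightarrow> s \<le> 31/4 \<Longrightarrow>
     on_piece (19 + s) (72 - 9 * s) (216 - 27 * s)"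

text \<open>Crude bounds suffice here; they leave only a few multiples of 144 by which two pieces
  could be translated onto each other.\<close>

lemma on_piece_bound: "on_piece r x y \<Longrightarrow> -167 \<le> x \<and> x \<le> 151"
  by (erule on_piece.cases; argo)

text \<open>At a corner the two edge directions are independent, so the position determines
  \<open>a\<close> and \<open>b\<close> and with them the time. For each of the five possible
  translates, every pair of pieces is a matter of linear arithmetic.\<close>

lemma on_piece_inj:
  assumes "on_piece r x y" "on_piece r' x' y" "x + 144 * k = x'"
    and "k = real_of_int K"
  shows "r + 40 * k = r'"
proof -
  have "\<bar>k\<bar> < 3"
    using on_piece_bound[OF assms(1)] on_piece_bound[OF assms(2)] assms(3) by linarith
  then have "K \<in> {-2,-1,0,1,2}" using assms(4) by auto
  then have K: "k = -2 \<or> k = -1 \<or> k = 0 \<or> k = 1 \<or> k = 2" using assms(4) by auto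
  show ?thesis
    using assms(1,2)
    by (elim on_piece.cases; use assms(3) K in argo)
qed

text \<open>
  The ten pairs of times describe five crossings: \<open>(a, b)\<close> and \<open>(b + 40, a)\<close> give the same double
  point of the closed curve.  The first pair is the one that produces \<open>C\<^sub>2\<^sub>n\<^sub>+\<^sub>1\<close>.
\<close>

definition crossings :: "(real \<times> real) set" where
  "crossings =
    {(0, 20), (60, 0), (-35/13, -103/13), (417/13, -35/13), (59/5, -41/5), (159/5, 59/5),
     (241/11, -107/11), (333/11, 241/11), (25/7, 141/7), (421/7, 25/7)}"

text \<open>Four translates remain; for each pair of pieces linear arithmetic either refutes a
  meeting or determines both times.\<close>

lemma on_piece_crossing:
  assumes "on_piece r x y" "on_piece r' x' y" "x + 144 * k = x' + 72"
    and "k = real_of_int K"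
  shows "(r + 40 * k, r') \<in> crossings"
proof -
  have "-2 < k \<and> k < 3"
    using on_piece_bound[OF assms(1)] on_piece_bound[OF assms(2)] assms(3) by linarith
  then have "K \<in> {-1,0,1,2}" using assms(4) by auto
  then have K: "k = -1 \<or> k = 0 \<or> k = 1 \<or> k = 2" using assms(4) by auto
  show ?thesis
    unfolding crossings_def insert_iff empty_iff prod.inject
    using assms(1,2)
    by (elim on_piece.cases; use assms(3) K in argo)
qed

subsection \<open>The unrolled curve\<close>

definition smooth_step :: "real \<Rightarrow> real" where
  "smooth_step s = flat_exp 1 (s + 1/8) * inverse (flat_exp 1 (s + 1/8) + flat_exp 1 (1/8 - s))"

text \<open>A smooth substitute for max(0, s) that deviates from it only within distance 1/8 of 0,
  so that adding its translates rounds off corners and leaves the rest of the edges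
  straight.\<close>

definition ramp :: "real \<Rightarrow> real" where
  "ramp s = s * smooth_step s"

lemma flat_exp_1: "flat_exp 1 x \<ge> 0" "flat_exp 1 x > 0 \<longleftrightarrow> x > 0" "x \<le> 0 \<Longrightarrow> flat_exp 1 x = 0"
  by (auto simp: flat_exp_def)

lemma flat_exp_1_sum_pos: "flat_exp 1 (s + 1/8) + flat_exp 1 (1/8 - s) > 0"
proof -
  have "s + 1/8 > 0 \<or> 1/8 - s > 0" by linarith
  then have "flat_exp 1 (s + 1/8) > 0 \<or> flat_exp 1 (1/8 - s) > 0" by (simp only: flat_exp_1(2))
  then show ?thesis using flat_exp_1(1)[of "s + 1/8"] flat_exp_1(1)[of "1/8 - s"] by linarith
qed

lemma smooth_step_bounds: "0 \<le> smooth_step s" "smooth_step s \<le> 1"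
  using flat_exp_1_sum_pos[of s] flat_exp_1(1)[of "s + 1/8"] flat_exp_1(1)[of "1/8 - s"]
  by (auto simp: smooth_step_def divide_inverse[symmetric])

lemma ramp_left: "s \<le> - (1/8) \<Longrightarrow> ramp s = 0"
  by (simp add: ramp_def smooth_step_def flat_exp_1(3))

lemma ramp_right: "s \<ge> 1/8 \<Longrightarrow> ramp s = s"
  using flat_exp_1_sum_pos[of s] by (simp add: ramp_def smooth_step_def flat_exp_1(3))

text \<open>Since \<open>ramp s\<close> lies between 0 and \<open>s\<close>, both shares into which
  it splits the elapsed time around a corner are bounded by that time.\<close>

lemma ramp_corner:
  assumes "\<bar>s\<bar> \<le> c"
  shows "\<bar>ramp s\<bar> \<le> c" "\<bar>s - ramp s\<bar> \<le> c"
proof -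
  have "\<bar>ramp s\<bar> \<le> \<bar>s\<bar> * 1"
    unfolding ramp_def abs_mult using smooth_step_bounds[of s] by (intro mult_left_mono) auto
  then show "\<bar>ramp s\<bar> \<le> c" using assms by linarith
  have "\<bar>s * (1 - smooth_step s)\<bar> \<le> \<bar>s\<bar> * 1"
    unfolding abs_mult using smooth_step_bounds[of s] by (intro mult_left_mono) auto
  then show "\<bar>s - ramp s\<bar> \<le> c" using assms by (simp add: ramp_def algebra_simps)
qed

lemma smooth_fun_ramp: "smooth_fun ramp"
proof -
  have 1: "smooth_fun (\<lambda>s. flat_exp 1 (s + 1/8))" "smooth_fun (\<lambda>s. flat_exp 1 (1/8 - s))"
    using smooth_fun_affine[OF smooth_fun_flat_exp[of 1], of 1 "1/8"]
      smooth_fun_affine[OF smooth_fun_flat_exp[of 1], of "-1" "1/8"]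
    by simp_all
  show ?thesis
    unfolding ramp_def smooth_step_def
    using flat_exp_1_sum_pos less_imp_neq[THEN not_sym]
    by (intro smooth_fun_mult smooth_fun_id smooth_fun_inverse smooth_fun_add 1) blast
qed

text \<open>
  Near each corner the ramps change the velocity from that of one edge to that of the next, so one
  period \<open>-17 \<le> r \<le> 107/4\<close> is smooth and overlaps with its translate along the last edge.
\<close>

definition base_curve :: "real \<Rightarrow> complex" where
  "base_curve r = Complex (-144) 0 + of_real (r + 13) * Complex (-9) (-27)
     + of_real (ramp (r + 13)) * Complex 45 69 + of_real (ramp (r + 7)) * Complex (-27) (-51)
     + of_real (ramp (r - 1)) * Complex (-13) 11 + of_real (ramp (r - 19)) * Complex (-5) (-29)"

lemma Re_Im_base_curve:
  "Re (base_curve r) = -144 - 9 * (r + 13) + 45 * ramp (r + 13) - 27 * ramp (r + 7)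
     - 13 * ramp (r - 1) - 5 * ramp (r - 19)"
  "Im (base_curve r) = - 27 * (r + 13) + 69 * ramp (r + 13) - 51 * ramp (r + 7)
     + 11 * ramp (r - 1) - 29 * ramp (r - 19)"
  by (simp_all add: base_curve_def)

text \<open>Near a corner at time \<open>v\<close> the share \<open>r - v - ramp (r - v)\<close> is
  charged to the incoming edge and \<open>ramp (r - v)\<close> to the outgoing one; away from
  corners every ramp is 0 or linear. The range of \<open>r\<close> starts a quarter before the first
  corner and has length 40.\<close>

lemma on_piece_base_curve:
  assumes "-53/4 \<le> r" "r \<le> 107/4"
  shows "on_piece r (Re (base_curve r)) (Im (base_curve r))"
proof -
  have corner: "-1/4 \<le> ramp (r - v)" "ramp (r - v) \<le> 1/4"
    "-1/4 \<le> r - v - ramp (r - v)" "r - v - ramp (r - v) \<le> 1/4" if "v - 1/4 \<le> r" "r \<le> v + 1/4" for v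
  proof -
    have "\<bar>r - v\<bar> \<le> 1/4" using that by linarith
    from ramp_corner[OF this] show "-1/4 \<le> ramp (r - v)" "ramp (r - v) \<le> 1/4"
      "-1/4 \<le> r - v - ramp (r - v)" "r - v - ramp (r - v) \<le> 1/4"
      by linarith+
  qed
  have left: "ramp (r - v) = 0" if "r \<le> v - 1/4" for v using that by (intro ramp_left) auto
  have right: "ramp (r - v) = r - v" if "r \<ge> v + 1/4" for v using that by (intro ramp_right) auto
  let ?P = "\<lambda>x y. on_piece r x y"
  have P: "?P (Re (base_curve r)) (Im (base_curve r))"
    if "on_piece r' x y" "r = r'" "Re (base_curve r) = x" "Im (base_curve r) = y" for r' x y
    using that by simp
  consider "r \<le> -13 + 1/4" | "-13 + 1/4 \<le> r" "r \<le> -7 - 1/4" | "-7 - 1/4 \<le> r" "r \<le> -7 + 1/4"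
    | "-7 + 1/4 \<le> r" "r \<le> 1 - 1/4" | "1 - 1/4 \<le> r" "r \<le> 1 + 1/4" | "1 + 1/4 \<le> r" "r \<le> 19 - 1/4"
    | "19 - 1/4 \<le> r" "r \<le> 19 + 1/4" | "19 + 1/4 \<le> r"
    by linarith
  then show ?thesis
  proof cases
    case 1
    show ?thesis
      using corner[of "-13"] left[of "-7"] left[of 1] left[of 19] 1 assms
      by (intro P[OF on_piece.intros(1)[of "r + 13 - ramp (r + 13)" "ramp (r + 13)"]])
         (auto simp: Re_Im_base_curve)
  next
    case 2
    show ?thesis
      using right[of "-13"] left[of "-7"] left[of 1] left[of 19] 2
      by (intro P[OF on_piece.intros(2)[of "r + 13"]]) (auto simp: Re_Im_base_curve)
  next
    case 3
    show ?thesis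
      using right[of "-13"] corner[of "-7"] left[of 1] left[of 19] 3
      by (intro P[OF on_piece.intros(3)[of "r + 7 - ramp (r + 7)" "ramp (r + 7)"]])
         (auto simp: Re_Im_base_curve)
  next
    case 4
    show ?thesis
      using right[of "-13"] right[of "-7"] left[of 1] left[of 19] 4
      by (intro P[OF on_piece.intros(4)[of "r + 7"]]) (auto simp: Re_Im_base_curve)
  next
    case 5
    show ?thesis
      using right[of "-13"] right[of "-7"] corner[of 1] left[of 19] 5
      by (intro P[OF on_piece.intros(5)[of "r - 1 - ramp (r - 1)" "ramp (r - 1)"]])
         (auto simp: Re_Im_base_curve)
  next
    case 6
    show ?thesis
      using right[of "-13"] right[of "-7"] right[of 1] left[of 19] 6
      by (intro P[OF on_piece.intros(6)[of "r - 1"]]) (auto simp: Re_Im_base_curve)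
  next
    case 7
    show ?thesis
      using right[of "-13"] right[of "-7"] right[of 1] corner[of 19] 7
      by (intro P[OF on_piece.intros(7)[of "r - 19 - ramp (r - 19)" "ramp (r - 19)"]])
         (auto simp: Re_Im_base_curve)
  next
    case 8
    show ?thesis
      using right[of "-13"] right[of "-7"] right[of 1] right[of 19] 8 assms
      by (intro P[OF on_piece.intros(8)[of "r - 19"]]) (auto simp: Re_Im_base_curve)
  qed
qed

text \<open>The windows of length 40 start at -17, the midpoint of a last edge, so that consecutive
  pieces join along a straight segment.\<close>

definition curve :: "real \<Rightarrow> complex" where
  "curve t = base_curve (t - 40 * of_int \<lfloor>(t + 17) / 40\<rfloor>) + 144 * of_int \<lfloor>(t + 17) / 40\<rfloor>"

lemma curve_eq_base:
  fixes t :: real and k :: int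
  assumes "-17 \<le> t - 40 * of_int k" "t - 40 * of_int k \<le> 107/4"
  shows "curve t = base_curve (t - 40 * of_int k) + 144 * of_int k"
proof (cases "t - 40 * of_int k < 23")
  case True
  then have "\<lfloor>(t + 17) / 40\<rfloor> = k"
    using assms by (intro floor_unique) (auto simp: field_simps)
  then show ?thesis by (simp add: curve_def)
next
  case False
  \<comment> \<open>In the overlap the floor already selects the next window, but both formulas
    describe the same straight edge.\<close>
  then have "\<lfloor>(t + 17) / 40\<rfloor> = k + 1"
    using assms by (intro floor_unique) (auto simp: field_simps)
  then have "curve t = (base_curve (t - 40 * of_int k - 40) + 144) + 144 * of_int k"
    by (simp add: curve_def algebra_simps)
  also have "base_curve (t - 40 * of_int k - 40) + 144 = base_curve (t - 40 * of_int k)"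
    using False assms by (intro complex_eqI) (simp_all add: Re_Im_base_curve ramp_left ramp_right)
  finally show ?thesis .
qed

lemma curve_shift: "curve (t + 40 * of_int k) = curve t + 144 * of_int k"
proof -
  have "(t + 40 * of_int k + 17) / 40 = (t + 17) / 40 + of_int k" by (simp add: field_simps)
  then have "\<lfloor>(t + 40 * of_int k + 17) / 40\<rfloor> = \<lfloor>(t + 17) / 40\<rfloor> + k"
    by (simp only: floor_add_int)
  then show ?thesis by (simp add: curve_def algebra_simps)
qed

lemma real_remainder:
  fixes c x :: real
  assumes "c > 0"
  obtains k :: int where "0 \<le> x - c * of_int k" "x - c * of_int k < c"
proof -
  obtain k :: int where "real_of_int k \<le> x / c" "x / c < real_of_int (k + 1)"
    using floor_exists[of "x / c"] by blast
  then show thesis using that[of k] assms by (simp add: field_simps)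
qed

lemma on_piece_curve:
  fixes t :: real
  obtains k :: int and r where "t = r + 40 * of_int k"
    "on_piece r (Re (curve t) - 144 * of_int k) (Im (curve t))"
proof -
  obtain k :: int where k: "0 \<le> t + 53/4 - 40 * of_int k" "t + 53/4 - 40 * of_int k < 40"
    using real_remainder[of 40 "t + 53/4"] by auto
  then have b: "-53/4 \<le> t - 40 * of_int k" "t - 40 * of_int k \<le> 107/4"
    by simp_all
  moreover from this have "curve t = base_curve (t - 40 * of_int k) + 144 * of_int k"
    by (intro curve_eq_base) simp_all
  ultimately have "on_piece (t - 40 * of_int k) (Re (curve t) - 144 * of_int k) (Im (curve t))"
    using on_piece_base_curve[of "t - 40 * of_int k"] by simp
  then show thesis using that[of "t - 40 * of_int k" k] by simp
qed

lemma curve_inj: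
  assumes "curve t = curve t' + 144 * of_int j"
  shows "t = t' + 40 * of_int j"
proof -
  obtain k r where k: "t = r + 40 * of_int k" "on_piece r (Re (curve t) - 144 * of_int k) (Im (curve t))"
    using on_piece_curve by blast
  obtain k' r' where k': "t' = r' + 40 * of_int k'"
    "on_piece r' (Re (curve t') - 144 * of_int k') (Im (curve t'))"
    using on_piece_curve by blast
  have "Im (curve t) = Im (curve t')" using assms by simp
  moreover have "Re (curve t) - 144 * of_int k + 144 * of_int (k - k' - j) = Re (curve t') - 144 * of_int k'"
    using assms by simp
  ultimately show ?thesis
    using on_piece_inj[OF k(2) _ _ refl, of r' _ "k - k' - j"] k k' by (auto simp: algebra_simps)
qed

lemma curve_crossing:
  assumes "curve t = curve t' + 72"
  obtains k :: int where "(t - 40 * of_int k, t' - 40 * of_int k) \<in> crossings"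
proof -
  obtain k r where k: "t = r + 40 * of_int k" "on_piece r (Re (curve t) - 144 * of_int k) (Im (curve t))"
    using on_piece_curve by blast
  obtain k' r' where k': "t' = r' + 40 * of_int k'"
    "on_piece r' (Re (curve t') - 144 * of_int k') (Im (curve t'))"
    using on_piece_curve by blast
  have "Im (curve t) = Im (curve t')" using assms by simp
  moreover have "Re (curve t) - 144 * of_int k + 144 * of_int (k - k') = Re (curve t') - 144 * of_int k' + 72"
    using assms by simp
  ultimately have "(r + 40 * of_int (k - k'), r') \<in> crossings"
    using on_piece_crossing[OF k(2) _ _ refl, of r' _ "k - k'"] k k' by auto
  then show thesis using that[of k'] k k' by (simp add: algebra_simps)
qed

text \<open>Time 0 lies on the second edge at (135, 189), time 20 on the third... fourth-listed
  straight stretch at (63, 189).\<close>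

lemma curve_0: "curve 0 = curve 20 + 72"
  using curve_eq_base[of 0 0] curve_eq_base[of 20 0]
  by (intro complex_eqI) (simp_all add: Re_Im_base_curve ramp_left ramp_right)

section \<open>Smoothness, regularity and transversality of the unrolled curve\<close>

lemma base_chart:
  obtains k :: int where "t \<in> {-17 + 40 * real_of_int k <..< 26 + 40 * real_of_int k}"
proof -
  obtain k :: int where "0 \<le> t + 16 - 40 * of_int k" "t + 16 - 40 * of_int k < 40"
    using real_remainder[of 40 "t + 16"] by auto
  then show thesis using that[of k] by simp
qed

lemma smooth_fun_base_curve: "smooth_fun base_curve"
proof -
  have aff: "smooth_fun (\<lambda>r. complex_of_real (u (r - b)) * w)" if "smooth_fun u" for u :: "real \<Rightarrow> real" and b w
    using smooth_fun_affine[OF that, of 1 "-b"] by (intro smooth_fun_mult smooth_fun_const smooth_fun_of_real) simp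
  show ?thesis
    unfolding base_curve_def[abs_def]
    using aff[OF smooth_fun_ramp, of "-13"] aff[OF smooth_fun_ramp, of "-7"] aff[OF smooth_fun_ramp, of 1]
      aff[OF smooth_fun_ramp, of 19] aff[OF smooth_fun_id, of "-13"]
    by (intro smooth_fun_add smooth_fun_const) simp_all
qed

lemma smooth_fun_curve: "smooth_fun curve"
proof (rule smooth_fun_localI)
  fix t :: real
  obtain k :: int where k: "t \<in> {-17 + 40 * real_of_int k <..< 26 + 40 * of_int k}" using base_chart by blast
  have "smooth_fun (\<lambda>t. base_curve (1 * t + (- 40 * of_int k)) + 144 * of_int k)"
    by (intro smooth_fun_affine[OF smooth_fun_base_curve] smooth_fun_add smooth_fun_const)
  moreover have "\<forall>s\<in>{-17 + 40 * real_of_int k <..< 26 + 40 * of_int k}. curve s = base_curve (1 * s + (- 40 * of_int k)) + 144 * of_int k"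
    using curve_eq_base[where k = k] by auto
  ultimately show "\<exists>U h. open U \<and> t \<in> U \<and> smooth_fun h \<and> (\<forall>s\<in>U. curve s = h s)"
    using k open_greaterThanLessThan by blast
qed

text \<open>The thresholds 1/4 lie strictly outside the transition zone, so \<open>ramp\<close>
  agrees with 0 or the identity on a whole neighbourhood.\<close>

lemma ramp_derivative:
  obtains r' where "\<And>s. (ramp has_vector_derivative r' s) (at s)"
    "\<And>s. s \<le> - (1/4) \<Longrightarrow> r' s = 0" "\<And>s. s \<ge> 1/4 \<Longrightarrow> r' s = 1"
proof -
  have "times_differentiable (Suc 0) ramp"
    using smooth_fun_ramp unfolding smooth_fun_def by blast
  then obtain r' where r': "\<And>s. (ramp has_vector_derivative r' s) (at s)" by auto
  have "r' s = 0" if "s \<le> - (1/4)" for s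
  proof -
    have "((\<lambda>s::real. 0::real) has_vector_derivative 0) (at s)" by simp
    then have "(ramp has_vector_derivative 0) (at s)"
      by (rule has_vector_derivative_transform_within_open[where S = "{..< - (1/8)}"])
         (use that in \<open>auto simp: ramp_left\<close>)
    then show ?thesis using r' vector_derivative_unique_at by blast
  qed
  moreover have "r' s = 1" if "s \<ge> 1/4" for s
  proof -
    have "((\<lambda>s::real. s) has_vector_derivative 1) (at s)" by simp
    then have "(ramp has_vector_derivative 1) (at s)"
      by (rule has_vector_derivative_transform_within_open[where S = "{1/8 <..}"])
         (use that in \<open>auto simp: ramp_right\<close>)
    then show ?thesis using r' vector_derivative_unique_at by blast
  qed
  ultimately show thesis using that r' by blast
qed

lemma curve_derivative_of_base:
  fixes t :: real and k :: int
  assumes "-17 < t - 40 * of_int k" "t - 40 * of_int k < 107/4"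
    and "(base_curve has_vector_derivative w) (at (t - 40 * of_int k))"
  shows "(curve has_vector_derivative w) (at t)"
proof -
  have sh: "((\<lambda>s. s - 40 * real_of_int k) has_vector_derivative 1) (at t)"
    unfolding has_real_derivative_iff_has_vector_derivative[symmetric]
    by (auto intro!: derivative_eq_intros)
  have "((\<lambda>s. base_curve (s - 40 * of_int k) + 144 * of_int k) has_vector_derivative w) (at t)"
    using vector_diff_chain_at[OF sh, of base_curve w] assms(3)
    by (intro has_vector_derivative_add[where g' = 0, simplified]) (auto simp: o_def)
  then show ?thesis
    by (rule has_vector_derivative_transform_within_open
        [where S = "{-17 + 40 * real_of_int k <..< 107/4 + 40 * real_of_int k}"])
       (use assms in \<open>auto intro!: curve_eq_base[symmetric]\<close>)
qed

text \<open>At most one ramp is in transition at a time. Whatever the value of its derivative, the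
  velocity lies on the line through the velocities of two adjacent edges; these are linearly
  independent, so the line misses 0.\<close>

lemma curve_regular: "\<exists>w. (curve has_vector_derivative w) (at t) \<and> w \<noteq> 0"
proof -
  obtain r' where r': "\<And>s. (ramp has_vector_derivative r' s) (at s)"
    "\<And>s. s \<le> - (1/4) \<Longrightarrow> r' s = 0" "\<And>s. s \<ge> 1/4 \<Longrightarrow> r' s = 1"
    using ramp_derivative by blast
  obtain k :: int where "t \<in> {-17 + 40 * real_of_int k <..< 26 + 40 * real_of_int k}"
    using base_chart by blast
  define r where "r = t - 40 * of_int k"
  have r: "-17 < r" "r < 26" using \<open>t \<in> _\<close> by (auto simp: r_def)
  define w where "w = Complex (-9) (-27) + of_real (r' (r + 13)) * Complex 45 69
     + of_real (r' (r + 7)) * Complex (-27) (-51)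
     + of_real (r' (r - 1)) * Complex (-13) 11 + of_real (r' (r - 19)) * Complex (-5) (-29)"
  have aff: "((\<lambda>s. complex_of_real (u (s - b)) * v) has_vector_derivative complex_of_real (u' (r - b)) * v) (at r)"
    if u: "\<And>s. (u has_vector_derivative u' s) (at s)" for u u' :: "real \<Rightarrow> real" and b v
  proof -
    have "((\<lambda>s. s - b) has_vector_derivative 1) (at r)"
      unfolding has_real_derivative_iff_has_vector_derivative[symmetric]
      by (auto intro!: derivative_eq_intros)
    then have "((\<lambda>s. u (s - b)) has_vector_derivative u' (r - b)) (at r)"
      using vector_diff_chain_at[of "\<lambda>s. s - b" 1 r u "u' (r - b)"] u by (simp add: o_def)
    from bounded_linear.has_vector_derivative[OF bounded_linear_of_real this]
    show ?thesis by (rule has_vector_derivative_mult_left)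
  qed
  have "(base_curve has_vector_derivative w) (at r)"
    unfolding base_curve_def[abs_def] w_def
    using aff[of "\<lambda>s. s" "\<lambda>_. 1" "-13" "Complex (-9) (-27)"] aff[OF r'(1), of "-13"] aff[OF r'(1), of "-7"]
      aff[OF r'(1), of 1] aff[OF r'(1), of 19]
    by (intro has_vector_derivative_add) (auto intro!: derivative_eq_intros)
  then have "(curve has_vector_derivative w) (at t)"
    using r by (intro curve_derivative_of_base[where k = k]) (auto simp: r_def)
  moreover have "w \<noteq> 0"
  proof
    assume "w = 0"
    then have "Re w = 0" "Im w = 0" by simp_all
    then have *: "-9 + 45 * r' (r + 13) - 27 * r' (r + 7) - 13 * r' (r - 1) - 5 * r' (r - 19) = 0"
      "-27 + 69 * r' (r + 13) - 51 * r' (r + 7) + 11 * r' (r - 1) - 29 * r' (r - 19) = 0"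
      by (simp_all add: w_def)
    consider "r \<le> -10" | "-10 \<le> r" "r \<le> -3" | "-3 \<le> r" "r \<le> 10" | "10 \<le> r" by linarith
    then show False
    proof cases
      case 1 then show False using * r'(2)[of "r + 7"] r'(2)[of "r - 1"] r'(2)[of "r - 19"] by simp
    next
      case 2 then show False using * r'(3)[of "r + 13"] r'(2)[of "r - 1"] r'(2)[of "r - 19"] by simp
    next
      case 3 then show False using * r'(3)[of "r + 13"] r'(3)[of "r + 7"] r'(2)[of "r - 19"] by simp
    next
      case 4 then show False using * r'(3)[of "r + 13"] r'(3)[of "r + 7"] r'(3)[of "r - 1"] by simp
    qed
  qed
  ultimately show ?thesis by blast
qed

lemma curve_derivative_on_edge:
  fixes t a b :: real and v w :: complex and k :: int
  assumes "-17 \<le> a" "a < t - 40 * of_int k" "t - 40 * of_int k < b" "b \<le> 107/4"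
    and "\<And>r. a < r \<Longrightarrow> r < b \<Longrightarrow> base_curve r = of_real r * v + w"
  shows "(curve has_vector_derivative v) (at t)"
proof (rule curve_derivative_of_base[where k = k])
  have "((\<lambda>r. complex_of_real r * v + w) has_vector_derivative v) (at (t - 40 * of_int k))"
    by (auto intro!: derivative_eq_intros)
  then show "(base_curve has_vector_derivative v) (at (t - 40 * of_int k))"
    by (rule has_vector_derivative_transform_within_open[where S = "{a <..< b}"]) (use assms in auto)
qed (use assms in auto)

text \<open>The four intervals stay clear of the corners and contain, modulo 40, all times that
  occur in \<open>crossings\<close>.\<close>

lemma curve_derivative_edges:
  fixes t :: real and k :: int
  defines "r \<equiv> t - 40 * of_int k"
  shows "-12 < r \<Longrightarrow> r < -15/2 \<Longrightarrow> (curve has_vector_derivative Complex 36 42) (at t)"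
    and "-6 < r \<Longrightarrow> r < 1/2 \<Longrightarrow> (curve has_vector_derivative Complex 9 (-9)) (at t)"
    and "2 < r \<Longrightarrow> r < 18 \<Longrightarrow> (curve has_vector_derivative Complex (-4) 2) (at t)"
    and "39/2 < r \<Longrightarrow> r < 26 \<Longrightarrow> (curve has_vector_derivative Complex (-9) (-27)) (at t)"
proof -
  show "-12 < r \<Longrightarrow> r < -15/2 \<Longrightarrow> (curve has_vector_derivative Complex 36 42) (at t)"
    unfolding r_def
    by (rule curve_derivative_on_edge[where w = "Complex (-144 + 13 * 36) (13 * 42)" and k = k
          and a = "-12" and b = "-15/2"])
       (simp_all add: complex_eq_iff Re_Im_base_curve ramp_left ramp_right)
  show "-6 < r \<Longrightarrow> r < 1/2 \<Longrightarrow> (curve has_vector_derivative Complex 9 (-9)) (at t)"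
    unfolding r_def
    by (rule curve_derivative_on_edge[where w = "Complex (72 + 7 * 9) (252 - 7 * 9)" and k = k
          and a = "-6" and b = "1/2"])
       (simp_all add: complex_eq_iff Re_Im_base_curve ramp_left ramp_right)
  show "2 < r \<Longrightarrow> r < 18 \<Longrightarrow> (curve has_vector_derivative Complex (-4) 2) (at t)"
    unfolding r_def
    by (rule curve_derivative_on_edge[where w = "Complex (144 + 4) (180 - 2)" and k = k
          and a = 2 and b = 18])
       (simp_all add: complex_eq_iff Re_Im_base_curve ramp_left ramp_right)
  show "39/2 < r \<Longrightarrow> r < 26 \<Longrightarrow> (curve has_vector_derivative Complex (-9) (-27)) (at t)"
    unfolding r_def
    by (rule curve_derivative_on_edge[where w = "Complex (72 + 19 * 9) (216 + 19 * 27)" and k = k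
          and a = "39/2" and b = 26])
       (simp_all add: complex_eq_iff Re_Im_base_curve ramp_left ramp_right)
qed

lemma crossing_transversal:
  fixes t t' :: real and k :: int
  assumes "(t - 40 * of_int k, t' - 40 * of_int k) \<in> crossings"
  obtains v v' where "(curve has_vector_derivative v) (at t)" "(curve has_vector_derivative v') (at t')"
    "Re v * Im v' \<noteq> Im v * Re v'"
proof -
  note E = curve_derivative_edges
  \<comment> \<open>The period \<open>k + 1\<close> serves those first times of a crossing that
    exceed 27.\<close>
  note E0 = E[of _ k] and E1 = E[of _ "k + 1"]
  have ts: "t = (t - 40 * of_int k) + 40 * of_int k" "t' = (t' - 40 * of_int k) + 40 * of_int k"
    by simp_all
  from assms show thesis
    unfolding crossings_def insert_iff empty_iff prod.inject
  proof (elim disjE conjE)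
    assume h: "t - 40 * of_int k = 0" "t' - 40 * of_int k = 20"
    show thesis by (rule that[OF E0(2)[of t] E0(4)[of t']]) (use h in simp_all)
  next
    assume h: "t - 40 * of_int k = 60" "t' - 40 * of_int k = 0"
    show thesis by (rule that[OF E1(4)[of t] E0(2)[of t']]) (use h in simp_all)
  next
    assume h: "t - 40 * of_int k = -35/13" "t' - 40 * of_int k = -103/13"
    show thesis by (rule that[OF E0(2)[of t] E0(1)[of t']]) (use h in simp_all)
  next
    assume h: "t - 40 * of_int k = 417/13" "t' - 40 * of_int k = -35/13"
    show thesis by (rule that[OF E1(1)[of t] E0(2)[of t']]) (use h in simp_all)
  next
    assume h: "t - 40 * of_int k = 59/5" "t' - 40 * of_int k = -41/5"
    show thesis by (rule that[OF E0(3)[of t] E0(1)[of t']]) (use h in simp_all)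
  next
    assume h: "t - 40 * of_int k = 159/5" "t' - 40 * of_int k = 59/5"
    show thesis by (rule that[OF E1(1)[of t] E0(3)[of t']]) (use h in simp_all)
  next
    assume h: "t - 40 * of_int k = 241/11" "t' - 40 * of_int k = -107/11"
    show thesis by (rule that[OF E0(4)[of t] E0(1)[of t']]) (use h in simp_all)
  next
    assume h: "t - 40 * of_int k = 333/11" "t' - 40 * of_int k = 241/11"
    show thesis by (rule that[OF E1(1)[of t] E0(4)[of t']]) (use h in simp_all)
  next
    assume h: "t - 40 * of_int k = 25/7" "t' - 40 * of_int k = 141/7"
    show thesis by (rule that[OF E0(3)[of t] E0(4)[of t']]) (use h in simp_all)
  next
    assume h: "t - 40 * of_int k = 421/7" "t' - 40 * of_int k = 25/7"
    show thesis by (rule that[OF E1(4)[of t] E0(3)[of t']]) (use h in simp_all)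
  qed simp
qed

text \<open>A block runs from one corner at -13 modulo 40 to the next. No crossing time falls on a
  boundary, so all inequalities are strict.\<close>

lemma crossing_blocks:
  assumes "(a, b) \<in> crossings"
  shows "-13 < b" "b < 27" "\<exists>e::int. (e = 0 \<or> e = 1) \<and> -13 < a - 40 * of_int e \<and> a - 40 * of_int e < 27"
proof -
  show "-13 < b" "b < 27" using assms by (auto simp: crossings_def)
  have "(-13 < a \<and> a < 27) \<or> (-13 < a - 40 \<and> a - 40 < 27)"
    using assms by (auto simp: crossings_def)
  then show "\<exists>e::int. (e = 0 \<or> e = 1) \<and> -13 < a - 40 * of_int e \<and> a - 40 * of_int e < 27"
    by (metis of_int_0 of_int_1 mult_zero_right mult_1_right diff_zero)
qed

lemma span_two_complex:
  assumes "Re u * Im v \<noteq> Im u * Re v"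
  shows "span {u, v} = (UNIV :: complex set)"
proof (rule UNIV_eq_I[symmetric])
  fix z
  define D where "D = Re u * Im v - Im u * Re v"
  have "D \<noteq> 0" using assms by (simp add: D_def)
  \<comment> \<open>The coefficients come from Cramer's rule.\<close>
  have "z = ((Re z * Im v - Im z * Re v) / D) *\<^sub>R u + ((Re u * Im z - Im u * Re z) / D) *\<^sub>R v"
    using \<open>D \<noteq> 0\<close> by (intro complex_eqI) (simp_all add: field_simps, simp_all add: D_def algebra_simps)
  then show "z \<in> span {u, v}"
    by (metis insertI1 insertI2 span_add span_base span_scale)
qed

lemma cis_eq_iff: "cis s = cis t \<longleftrightarrow> (\<exists>k::int. s = t + 2 * pi * of_int k)"
proof -
  have "cis s = cis t \<longleftrightarrow> exp (\<i> * of_real s) = exp (\<i> * of_real t)"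
    by (simp add: cis_conv_exp)
  also have "\<dots> \<longleftrightarrow> (\<exists>k::int. s = t + 2 * pi * of_int k)"
    unfolding exp_eq by (simp add: complex_eq_iff algebra_simps)
  finally show ?thesis .
qed

lemma circle_cis: "z \<in> S1 \<Longrightarrow> \<exists>t. z = cis t"
proof (rule exI[of _ "Arg z"])
  assume "z \<in> S1"
  then have "z \<noteq> 0" "sgn z = z" by (auto simp: sgn_eq)
  then show "z = cis (Arg z)" using cis_Arg by simp
qed

subsection \<open>The closed curve\<close>

locale winding =
  fixes n :: nat
  assumes n_pos: "1 \<le> n"
begin

text \<open>One turn of the parameter circle takes time \<open>40 * (2 * n + 1)\<close>, which is
  \<open>2 * n + 1\<close> periods of the unrolled curve.\<close>

definition speed :: real where
  "speed = 20 * real (2 * n + 1) / pi"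

text \<open>Logarithmic polar coordinates: the imaginary part becomes the logarithm of the radius
  and the real part the angle, scaled so that \<open>72 * (2 * n + 1)\<close> is a full
  turn.\<close>

definition wrap :: "complex \<Rightarrow> complex" where
  "wrap z = of_real (Im z) + of_real (pi * Re z / (36 * real (2 * n + 1))) * \<i>"

definition lift :: "real \<Rightarrow> complex" where
  "lift t = exp (wrap (curve (speed * t)))"

definition immersion :: "complex \<Rightarrow> complex" where
  "immersion w = lift (Arg w)"

lemma speed_pos: "speed > 0"
  by (simp add: speed_def)

lemma speed_period: "speed * (t + 2 * pi * of_int k) = speed * t + 40 * of_int (int (2 * n + 1) * k)"
  by (simp add: speed_def field_simps)

lemma wrap_add_period:
  "wrap (z + 72 * of_int (int (2 * n + 1) * k)) = wrap z + of_int (2 * k) * pi * \<i>"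
proof -
  have "Re (z + 72 * of_int (int (2 * n + 1) * k)) = Re z + 72 * (real (2 * n + 1) * of_int k)"
    "Im (z + 72 * of_int (int (2 * n + 1) * k)) = Im z"
    by simp_all
  then show ?thesis
    by (intro complex_eqI) (simp_all only: wrap_def, simp_all add: field_simps)
qed

lemma lift_eq_iff:
  "lift s = lift t \<longleftrightarrow>
     (\<exists>k::int. curve (speed * s) = curve (speed * t) + 72 * of_int (int (2 * n + 1) * k))"
proof -
  have inj: "z = w" if "wrap z = wrap w" for z w
    using arg_cong[OF that, of Re] arg_cong[OF that, of Im] by (intro complex_eqI) (simp_all add: wrap_def field_simps)
  have "lift s = lift t \<longleftrightarrow>
    (\<exists>k::int. wrap (curve (speed * s)) = wrap (curve (speed * t) + 72 * of_int (int (2 * n + 1) * k)))"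
    unfolding lift_def exp_eq wrap_add_period by simp
  then show ?thesis using inj by metis
qed

lemma lift_periodic: "lift (t + 2 * pi * of_int k) = lift t"
  unfolding lift_eq_iff speed_period curve_shift
  by (rule exI[of _ "2 * k"]) simp

lemma immersion_cis: "immersion (cis t) = lift t"
proof -
  have "cis (Arg (cis t)) = cis t" by (simp add: cis_Arg sgn_div_norm)
  then show ?thesis
    using lift_periodic by (auto simp: cis_eq_iff immersion_def)
qed

text \<open>Equal values of \<open>lift\<close> mean a translation by k d T with d =
  \<open>2 * n + 1\<close> and T = 72. The integer \<open>j\<close> counts the full periods in it,
  and \<open>i\<close> is the period in which the remaining crossing occurs.\<close>

lemma lift_eq_cases:
  assumes "lift s = lift t" "cis s \<noteq> cis t"
  obtains k j i :: int where
    "curve (speed * s) = curve (speed * t) + 72 * of_int (int (2 * n + 1) * k)"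
    "odd k" "int (2 * n + 1) * k = 2 * j + 1"
    "(speed * s - 40 * of_int i, speed * t + 40 * of_int j - 40 * of_int i) \<in> crossings"
proof -
  obtain k :: int where k: "curve (speed * s) = curve (speed * t) + 72 * of_int (int (2 * n + 1) * k)"
    using assms(1) lift_eq_iff by auto
  have "odd k"
  proof
    assume "even k"
    then obtain l where "k = 2 * l" by blast
    \<comment> \<open>An even multiple corresponds to whole turns of the parameter circle, so
      injectivity of the unrolled curve makes the two parameters coincide there.\<close>
    then have "curve (speed * s) = curve (speed * t) + 144 * of_int (int (2 * n + 1) * l)"
      using k by simp
    from curve_inj[OF this] have "speed * s = speed * (t + 2 * pi * of_int l)"
      by (simp only: speed_period)
    then have "s = t + 2 * pi * of_int l" using speed_pos by simp
    then show False using assms(2) cis_eq_iff by blast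
  qed
  then have "odd (int (2 * n + 1) * k)" by simp
  then obtain j where j: "int (2 * n + 1) * k = 2 * j + 1" using oddE by blast
  \<comment> \<open>Absorbing \<open>j\<close> full periods into the time leaves a translation by
    72.\<close>
  have "curve (speed * s) = curve (speed * t + 40 * of_int j) + 72"
    unfolding curve_shift k j by simp
  then obtain i :: int where
    "(speed * s - 40 * of_int i, speed * t + 40 * of_int j - 40 * of_int i) \<in> crossings"
    using curve_crossing by blast
  then show thesis using that k \<open>odd k\<close> j by blast
qed

lemma bounded_linear_wrap: "bounded_linear wrap"
  unfolding linear_conv_bounded_linear[symmetric]
  by (rule linearI; rule complex_eqI) (simp_all add: wrap_def distrib_left add_divide_distrib)

lemma smooth_lift: "smooth_fun lift"
proof -
  have "smooth_fun (\<lambda>t. curve (speed * t + 0))"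
    by (rule smooth_fun_affine[OF smooth_fun_curve])
  then have "smooth_fun (\<lambda>t. wrap (curve (speed * t + 0)))"
    unfolding smooth_fun_def using times_differentiable_bounded_linear[OF bounded_linear_wrap] by blast
  then show ?thesis
    unfolding lift_def[abs_def] by (intro smooth_fun_exp) simp
qed

lemma lift_derivative:
  assumes "(curve has_vector_derivative v) (at (speed * t))"
  shows "vector_derivative lift (at t) = (of_real speed * lift t) * wrap v"
proof -
  have "((\<lambda>t. speed * t) has_vector_derivative speed) (at t)"
    unfolding has_real_derivative_iff_has_vector_derivative[symmetric]
    by (auto intro!: derivative_eq_intros)
  from vector_diff_chain_at[OF this assms]
  have "((\<lambda>t. curve (speed * t)) has_vector_derivative speed *\<^sub>R v) (at t)"
    by (simp add: o_def)
  from bounded_linear.has_vector_derivative[OF bounded_linear_wrap this]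
  have "((\<lambda>t. wrap (curve (speed * t))) has_vector_derivative speed *\<^sub>R wrap v) (at t)"
    by (simp add: linear_scale[OF bounded_linear.linear[OF bounded_linear_wrap]])
  from field_vector_diff_chain_at[OF this DERIV_exp]
  have "(lift has_vector_derivative (speed *\<^sub>R wrap v) * lift t) (at t)"
    by (simp add: o_def lift_def[abs_def])
  then show ?thesis by (simp add: vector_derivative_at scaleR_conv_of_real ac_simps)
qed

lemma tangent_at_immersion:
  assumes "(curve has_vector_derivative v) (at (speed * t))"
  shows "tangent_at immersion t = (of_real speed * lift t) * wrap v"
  unfolding tangent_at_def immersion_cis using lift_derivative[OF assms] by simp

lemma smooth_immersion_immersion: "smooth_immersion immersion"
  unfolding smooth_immersion_def immersion_cis
proof (intro conjI allI smooth_curveI)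
  show "smooth_fun (\<lambda>t. lift t)" using smooth_lift by simp
  show "tangent_at immersion t \<noteq> 0" for t
  proof -
    obtain w where w: "(curve has_vector_derivative w) (at (speed * t))" "w \<noteq> 0"
      using curve_regular by blast
    have "wrap w \<noteq> 0"
      using w(2) by (auto simp: wrap_def complex_eq_iff)
    then show ?thesis
      using tangent_at_immersion[OF w(1)] speed_pos by (simp add: lift_def)
  qed
qed

text \<open>At a double point both tangents are \<open>wrap\<close> of a velocity times the same
  nonzero factor, because the values of \<open>lift\<close> agree. That multiplication and
  \<open>wrap\<close> change the determinant only by nonzero factors.\<close>

lemma transversal_immersion: "transversal_multiple_points immersion"
  unfolding transversal_multiple_points_def immersion_cis
proof (intro allI impI)
  fix s t assume "cis s \<noteq> cis t \<and> lift s = lift t"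
  then obtain k j i :: int where
    "(speed * s - 40 * of_int i, speed * t + 40 * of_int j - 40 * of_int i) \<in> crossings"
    using lift_eq_cases by metis
  then obtain v v' where v: "(curve has_vector_derivative v) (at (speed * s))"
    "(curve has_vector_derivative v') (at (speed * t + 40 * of_int j))"
    "Re v * Im v' \<noteq> Im v * Re v'"
    using crossing_transversal by blast
  have "((\<lambda>x. x + 40 * real_of_int j) has_vector_derivative 1) (at (speed * t))"
    unfolding has_real_derivative_iff_has_vector_derivative[symmetric]
    by (auto intro!: derivative_eq_intros)
  from vector_diff_chain_at[OF this v(2)]
  have "((\<lambda>x. curve x + 144 * of_int j) has_vector_derivative v') (at (speed * t))"
    by (simp add: o_def curve_shift)
  from has_vector_derivative_diff[OF this has_vector_derivative_const[of "144 * of_int j"]]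
  have v': "(curve has_vector_derivative v') (at (speed * t))" by simp
  define c where "c = of_real speed * lift s"
  have "c \<noteq> 0" using speed_pos by (simp add: c_def lift_def)
  have T: "tangent_at immersion s = c * wrap v" "tangent_at immersion t = c * wrap v'"
    using tangent_at_immersion[OF v(1)] tangent_at_immersion[OF v'] \<open>cis s \<noteq> cis t \<and> lift s = lift t\<close>
    by (simp_all add: c_def)
  have det: "Re (c * x) * Im (c * y) - Im (c * x) * Re (c * y) = (cmod c)\<^sup>2 * (Re x * Im y - Im x * Re y)" for x y
    unfolding cmod_power2 by (simp add: power2_eq_square algebra_simps)
  have "Re (wrap v) * Im (wrap v') - Im (wrap v) * Re (wrap v')
      = (pi / (36 * real (2 * n + 1))) * (Im v * Re v' - Re v * Im v')"
    by (simp add: wrap_def diff_divide_distrib right_diff_distrib mult.left_commute mult.assoc)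
  then have "Re (wrap v) * Im (wrap v') - Im (wrap v) * Re (wrap v') \<noteq> 0"
    using v(3) by simp
  then have "Re (c * wrap v) * Im (c * wrap v') - Im (c * wrap v) * Re (c * wrap v') \<noteq> 0"
    unfolding det using \<open>c \<noteq> 0\<close> by simp
  then show "span {tangent_at immersion s, tangent_at immersion t} = UNIV"
    unfolding T by (intro span_two_complex) simp
qed

text \<open>Otherwise an odd number would be the sum of two odd numbers.\<close>

lemma lift_triple:
  assumes "lift s = lift t" "lift t = lift u"
  shows "cis s = cis t \<or> cis t = cis u \<or> cis s = cis u"
proof (rule ccontr)
  assume neg: "\<not> ?thesis"
  then have ne: "cis s \<noteq> cis t" "cis t \<noteq> cis u" "cis s \<noteq> cis u" by auto
  obtain k :: int where k: "curve (speed * s) = curve (speed * t) + 72 * of_int (int (2 * n + 1) * k)" "odd k"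
    using lift_eq_cases[OF assms(1) ne(1)] by metis
  obtain l :: int where l: "curve (speed * t) = curve (speed * u) + 72 * of_int (int (2 * n + 1) * l)" "odd l"
    using lift_eq_cases[OF assms(2) ne(2)] by metis
  obtain m :: int where m: "curve (speed * s) = curve (speed * u) + 72 * of_int (int (2 * n + 1) * m)" "odd m"
    using lift_eq_cases[OF _ ne(3)] assms by metis
  have "curve (speed * u) + 72 * of_int (int (2 * n + 1) * m)
      = curve (speed * u) + 72 * of_int (int (2 * n + 1) * l) + 72 * of_int (int (2 * n + 1) * k)"
    using k(1) l(1) m(1) by metis
  also have "\<dots> = curve (speed * u) + 72 * of_int (int (2 * n + 1) * l + int (2 * n + 1) * k)"
    by (simp only: of_int_add distrib_left add.assoc)
  finally have "complex_of_int (int (2 * n + 1) * m) = of_int (int (2 * n + 1) * l + int (2 * n + 1) * k)"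
    by (simp only: add_left_cancel mult_cancel_left) simp
  then have "int (2 * n + 1) * m = int (2 * n + 1) * (l + k)"
    by (simp only: of_int_eq_iff distrib_left)
  then have "m = l + k" by (simp only: mult_cancel_left) simp
  then show False using k(2) l(2) m(2) by simp
qed

lemma immersion_triple:
  assumes "x \<in> S1" "y \<in> S1" "z \<in> S1" "immersion x = immersion y" "immersion y = immersion z"
  shows "x = y \<or> y = z \<or> x = z"
  using assms circle_cis lift_triple by (metis immersion_cis)

lemma multiple_points_iff:
  "x \<in> multiple_points immersion \<longleftrightarrow>
     x \<in> S1 \<and> (\<exists>y\<in>S1. y \<noteq> x \<and> immersion y = immersion x)"
proof -
  have "is_singleton (fiber immersion (immersion x)) \<longleftrightarrow> (\<forall>y\<in>S1. immersion y = immersion x \<longrightarrow> y = x)"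
    if "x \<in> S1"
  proof
    assume "is_singleton (fiber immersion (immersion x))"
    then show "\<forall>y\<in>S1. immersion y = immersion x \<longrightarrow> y = x"
      using that by (metis (mono_tags, lifting) fiber_def is_singletonE mem_Collect_eq singletonD)
  next
    assume "\<forall>y\<in>S1. immersion y = immersion x \<longrightarrow> y = x"
    then have "fiber immersion (immersion x) = {x}"
      using that by (auto simp only: fiber_def)
    then show "is_singleton (fiber immersion (immersion x))" by simp
  qed
  then show ?thesis by (auto simp: multiple_points_def)
qed

lemma finitely_many_double_points_immersion: "finitely_many_double_points immersion"
  unfolding finitely_many_double_points_def
proof (intro conjI allI)
  define d where "d = 2 * n + 1"
  \<comment> \<open>Raising to the power \<open>d\<close> forgets the period \<open>i\<close>, so
    multiple points are roots of finitely many equations, one for each first entry of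
    \<open>crossings\<close>.\<close>
  have "multiple_points immersion \<subseteq> (\<Union>(a, b)\<in>crossings. {z. z ^ d = cis (pi * a / 20)})"
  proof
    fix x assume "x \<in> multiple_points immersion"
    then obtain s t where st: "x = cis s" "cis s \<noteq> cis t" "lift s = lift t"
      unfolding multiple_points_iff by (metis circle_cis immersion_cis)
    from lift_eq_cases[OF st(3,2)] obtain j i :: int where
      c: "(speed * s - 40 * of_int i, speed * t + 40 * of_int j - 40 * of_int i) \<in> crossings"
      by metis
    have "real d * s = pi * (speed * s - 40 * of_int i) / 20 + 2 * pi * of_int i"
      by (simp add: speed_def d_def field_simps)
    then have "x ^ d = cis (pi * (speed * s - 40 * of_int i) / 20)"
      unfolding st(1) Complex.DeMoivre cis_eq_iff by blast
    then show "x \<in> (\<Union>(a, b)\<in>crossings. {z. z ^ d = cis (pi * a / 20)})"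
      using c by blast
  qed
  moreover have "finite (\<Union>(a, b)\<in>crossings. {z. z ^ d = cis (pi * a / 20)})"
  proof (rule finite_UN_I)
    show "finite crossings" by (simp add: crossings_def)
    show "finite (case p of (a, b) \<Rightarrow> {z. z ^ d = cis (pi * a / 20)})" for p :: "real \<times> real"
      using finite_nth_roots[of d] by (cases p) (simp add: d_def)
  qed
  ultimately show "finite (multiple_points immersion)" by (rule finite_subset)
next
  fix y
  have two: "\<exists>a b. fiber immersion y \<subseteq> {a, b}"
  proof (cases "\<exists>a b. a \<in> fiber immersion y \<and> b \<in> fiber immersion y \<and> a \<noteq> b")
    case True
    then obtain a b where "a \<in> fiber immersion y" "b \<in> fiber immersion y" "a \<noteq> b" by blast
    then have "fiber immersion y \<subseteq> {a, b}"
      unfolding fiber_def using immersion_triple by (smt (verit) insertCI mem_Collect_eq subsetI)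
    then show ?thesis by blast
  qed blast
  then show "finite (fiber immersion y)" by (meson finite.emptyI finite_insert finite_subset)
  from two obtain a b where "fiber immersion y \<subseteq> {a, b}" by blast
  then have "card (fiber immersion y) \<le> card {a, b}" by (intro card_mono) auto
  also have "\<dots> \<le> 2" by (simp add: card_insert_if)
  finally show "card (fiber immersion y) \<le> 2" .
qed

text \<open>Here \<open>p\<close> and \<open>q\<close> are the blocks of the two parameters. The
  strict bounds allow closed arcs of whole blocks later on.\<close>

lemma lift_eq_blocks:
  assumes "lift s = lift t" "s < t" "t < s + 2 * pi"
  obtains p q :: int where "40 * of_int p < speed * s + 13" "speed * s + 13 < 40 * (of_int p + 1)"
    "40 * of_int q < speed * t + 13" "speed * t + 13 < 40 * (of_int q + 1)"
    "q = p + int n \<or> q = p + int n + 1"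
proof -
  have ne: "cis t \<noteq> cis s"
  proof
    assume "cis t = cis s"
    then obtain k :: int where "t = s + 2 * pi * of_int k" using cis_eq_iff by blast
    then have "0 < 2 * pi * of_int k" "2 * pi * of_int k < 2 * pi * 1" using assms by auto
    then have "0 < k" "k < 1" by (simp_all only: zero_less_mult_iff mult_less_cancel_left) auto
    then show False by simp
  qed
  obtain k j i :: int where kji: "int (2 * n + 1) * k = 2 * j + 1"
    "(speed * t - 40 * of_int i, speed * s + 40 * of_int j - 40 * of_int i) \<in> crossings"
    using lift_eq_cases[OF assms(1)[symmetric] ne] by metis
  from crossing_blocks[OF kji(2)] obtain e :: int where e: "e = 0 \<or> e = 1"
    "-13 < speed * t - 40 * of_int i - 40 * of_int e" "speed * t - 40 * of_int i - 40 * of_int e < 27"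
    "-13 < speed * s + 40 * of_int j - 40 * of_int i" "speed * s + 40 * of_int j - 40 * of_int i < 27"
    by blast
  define p q where "p = i - j" and "q = i + e"
  have pq: "40 * of_int p < speed * s + 13" "speed * s + 13 < 40 * (of_int p + 1)"
    "40 * of_int q < speed * t + 13" "speed * t + 13 < 40 * (of_int q + 1)"
    using e by (simp_all add: p_def q_def)
  have "speed * s < speed * t" "speed * t < speed * (s + 2 * pi * of_int 1)"
    using assms speed_pos by simp_all
  then have "speed * s < speed * t" "speed * t < speed * s + 40 * of_int (int (2 * n + 1) * 1)"
    by (simp_all only: speed_period)
  then have "real_of_int p < of_int q + 1" "real_of_int q < of_int (p + int (2 * n + 1)) + 1"
    using pq by simp_all
  then have "p \<le> q" "q \<le> p + int (2 * n + 1)" by linarith+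
  then have j: "0 \<le> j + e" "j + e \<le> int (2 * n + 1)" by (simp_all add: p_def q_def)
  \<comment> \<open>The bounds on \<open>j + e\<close> exclude other odd values: a negative
    \<open>k\<close> forces \<open>j\<close> to be at most -n - 1, and \<open>k\<close> at least 3
    forces \<open>j\<close> to be at least 3n + 1.\<close>
  have "k = 1"
  proof (rule ccontr)
    assume "k \<noteq> 1"
    have "odd k" using kji(1) by (metis dvd_triv_left even_mult_iff even_plus_one_iff)
    then have "k \<noteq> 2" "k \<noteq> 0" by auto
    then have "k \<ge> 3 \<or> k \<le> -1" using \<open>k \<noteq> 1\<close> by linarith
    then have "int (2 * n + 1) * k \<ge> int (2 * n + 1) * 3 \<or> int (2 * n + 1) * k \<le> int (2 * n + 1) * (-1)"
      by (meson mult_left_mono of_nat_0_le_iff)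
    then show False using kji(1) j e(1) n_pos by auto
  qed
  then have "j = int n" using kji(1) by simp
  then have "q = p + int n \<or> q = p + int n + 1" using e(1) by (auto simp: p_def q_def)
  then show thesis using that pq by blast
qed

end

subsection \<open>Odd polygon diagrams\<close>

text \<open>The vertices of the regular (4m+2)-gon, indexed by all integers to avoid truncated
  subtraction and wrap-around.\<close>

definition vertex :: "nat \<Rightarrow> int \<Rightarrow> complex" where
  "vertex m k = cis (pi * of_int k / real (2 * m + 1))"

lemma vertex_eq_iff: "vertex m a = vertex m b \<longleftrightarrow> int (4 * m + 2) dvd a - b"
proof -
  have "pi * of_int a / real (2 * m + 1) = pi * of_int b / real (2 * m + 1) + 2 * pi * of_int k \<longleftrightarrow>
      a - b = int (4 * m + 2) * k" for k
  proof -
    have "pi * of_int a / real (2 * m + 1) = pi * of_int b / real (2 * m + 1) + 2 * pi * of_int k \<longleftrightarrow>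
      real_of_int (a - b) = real_of_int (int (4 * m + 2) * k)"
      by (simp add: field_simps) (simp add: distrib_left[symmetric])
    then show ?thesis by (simp only: of_int_eq_iff)
  qed
  then show ?thesis unfolding vertex_def cis_eq_iff dvd_def by simp
qed

lemma polygon_vertex_eq: "polygon_vertex (4 * m + 2) i = vertex m (int i)"
proof -
  have "2 * pi * real i / real (4 * m + 2) = pi * of_int (int i) / real (2 * m + 1)"
    by (simp add: field_simps)
  then show ?thesis unfolding polygon_vertex_def vertex_def by (simp only:)
qed

lemma polygon_chords_eq:
  assumes "m \<ge> 1"
  shows "(\<lambda>i. polygon_chord (4 * m + 2) (2 * i - 1) (2 * m - 1)) ` {1..2 * m + 1} =
    range (\<lambda>i. {vertex m (2 * i + 1), vertex m (2 * i + 2 * int m)})"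
proof -
  have chord: "polygon_chord (4 * m + 2) (2 * i - 1) (2 * m - 1) =
      {vertex m (2 * (int i - 1) + 1), vertex m (2 * (int i - 1) + 2 * int m)}" if "i \<ge> 1" for i
  proof -
    have "int (2 * i - 1) = 2 * (int i - 1) + 1"
      "int (2 * i - 1 + (2 * m - 1)) = 2 * (int i - 1) + 2 * int m"
      using that assms by auto
    then show ?thesis unfolding polygon_chord_def polygon_vertex_eq by (simp only:)
  qed
  show ?thesis
  proof (intro equalityI subsetI)
    fix c assume "c \<in> (\<lambda>i. polygon_chord (4 * m + 2) (2 * i - 1) (2 * m - 1)) ` {1..2 * m + 1}"
    then obtain i where "i \<ge> 1" "c = polygon_chord (4 * m + 2) (2 * i - 1) (2 * m - 1)" by auto
    then show "c \<in> range (\<lambda>i. {vertex m (2 * i + 1), vertex m (2 * i + 2 * int m)})"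
      unfolding chord[OF \<open>i \<ge> 1\<close>] by blast
  next
    fix c assume "c \<in> range (\<lambda>i. {vertex m (2 * i + 1), vertex m (2 * i + 2 * int m)})"
    then obtain i where c: "c = {vertex m (2 * i + 1), vertex m (2 * i + 2 * int m)}" by blast
    define j where "j = i mod int (2 * m + 1)"
    have j: "0 \<le> j" "j < int (2 * m + 1)" by (simp_all add: j_def)
    have "int (2 * m + 1) dvd i - j" by (simp add: j_def)
    then have "2 * int (2 * m + 1) dvd 2 * (i - j)" by (rule mult_dvd_mono[OF dvd_refl])
    then have "vertex m (2 * i + 1) = vertex m (2 * j + 1)"
      "vertex m (2 * i + 2 * int m) = vertex m (2 * j + 2 * int m)"
      by (simp_all add: vertex_eq_iff algebra_simps)
    then have "c = polygon_chord (4 * m + 2) (2 * nat (j + 1) - 1) (2 * m - 1)"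
      using j chord[of "nat (j + 1)"] c by simp
    moreover have "nat (j + 1) \<in> {1..2 * m + 1}" using j by auto
    ultimately show "c \<in> (\<lambda>i. polygon_chord (4 * m + 2) (2 * i - 1) (2 * m - 1)) ` {1..2 * m + 1}"
      by blast
  qed
qed

lemma polygon_diagram_points:
  assumes "m \<ge> 1"
  shows "fst (odd_polygon_diagram m) = range (vertex m)"
proof -
  have "vertex m k \<in> (\<Union>i. {vertex m (2 * i + 1), vertex m (2 * i + 2 * int m)})" for k
  proof (cases "even k")
    case True
    then have "k = 2 * (k div 2 - int m) + 2 * int m" by (simp add: algebra_simps)
    then show ?thesis by (metis (no_types, lifting) UN_iff UNIV_I insertCI)
  next
    case False
    then have "k = 2 * (k div 2) + 1" by simp
    then show ?thesis by (metis (no_types, lifting) UN_iff UNIV_I insertCI)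
  qed
  then show ?thesis
    unfolding odd_polygon_diagram_def diagram_of_chords_def polygon_chords_eq[OF assms] by auto
qed

text \<open>Each chord joins an odd vertex to an even one, and parity is well defined modulo
  \<open>4 * m + 2\<close>; this makes the partner in the definite description unique.\<close>

lemma polygon_diagram_involution:
  assumes "m \<ge> 1"
  shows "snd (odd_polygon_diagram m) (vertex m (2 * i + 1)) = vertex m (2 * i + 2 * int m)"
    and "snd (odd_polygon_diagram m) (vertex m (2 * i + 2 * int m)) = vertex m (2 * i + 1)"
proof -
  let ?K = "range (\<lambda>i. {vertex m (2 * i + 1), vertex m (2 * i + 2 * int m)})"
  have snd: "snd (odd_polygon_diagram m) x = (THE y. {x, y} \<in> ?K)" for x
    unfolding odd_polygon_diagram_def diagram_of_chords_def polygon_chords_eq[OF assms] by simp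
  have parity: "vertex m (2 * a + 1) \<noteq> vertex m (2 * b + 2 * int m)" for a b
  proof
    assume "vertex m (2 * a + 1) = vertex m (2 * b + 2 * int m)"
    then have "int (4 * m + 2) dvd 2 * a + 1 - (2 * b + 2 * int m)" by (simp only: vertex_eq_iff)
    moreover have "2 dvd int (4 * m + 2)" by simp
    ultimately have "2 dvd 2 * a + 1 - (2 * b + 2 * int m)" by (rule dvd_trans[rotated])
    then show False by presburger
  qed
  have shift: "vertex m (2 * a + 1) = vertex m (2 * b + 1) \<longleftrightarrow>
      vertex m (2 * a + 2 * int m) = vertex m (2 * b + 2 * int m)" for a b
    by (simp add: vertex_eq_iff)
  show "snd (odd_polygon_diagram m) (vertex m (2 * i + 1)) = vertex m (2 * i + 2 * int m)"
    unfolding snd using parity shift by (intro the_equality) (auto simp: doubleton_eq_iff)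
  show "snd (odd_polygon_diagram m) (vertex m (2 * i + 2 * int m)) = vertex m (2 * i + 1)"
    unfolding snd using parity parity[symmetric] shift by (intro the_equality) (auto simp: doubleton_eq_iff)
qed

section \<open>Lifts of circle homeomorphisms, and arcs of the circle\<close>

lemma orientation_preserving_lift_period:
  assumes h: "homeomorphism S1 S1 h g" and H: "continuous_on UNIV H" "strict_mono H"
    and lift: "\<And>t. h (cis t) = cis (H t)"
  shows "H (t + 2 * pi) = H t + 2 * pi"
proof -
  have inj: "inj_on h S1"
    using h by (metis homeomorphism_apply1 inj_on_inverseI)
  have "cis (H (t + 2 * pi)) = cis (H t)"
    using lift by (metis cis_eq_iff mult.right_neutral of_int_1)
  then obtain k :: int where k: "H (t + 2 * pi) = H t + 2 * pi * of_int k"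
    unfolding cis_eq_iff by blast
  have "H t < H (t + 2 * pi)" using H(2) by (simp add: strict_mono_def)
  then have "0 < 2 * pi * real_of_int k" using k by simp
  then have "k \<ge> 1" by (simp add: zero_less_mult_iff)
  \<comment> \<open>If \<open>H\<close> gained two turns or more, it would gain exactly one at some
    \<open>u\<close> strictly inside the period, against injectivity of \<open>h\<close>.\<close>
  moreover have "k < 2"
  proof (rule ccontr)
    assume "\<not> k < 2"
    then have "2 * pi * 2 \<le> 2 * pi * real_of_int k" by (intro mult_left_mono) auto
    then have "H t + 2 * pi \<le> H (t + 2 * pi)" using k by simp
    moreover have "H t \<le> H t + 2 * pi" by simp
    moreover have "continuous_on {t..t + 2 * pi} H" using H(1) continuous_on_subset by blast
    ultimately obtain u where u: "t \<le> u" "u \<le> t + 2 * pi" "H u = H t + 2 * pi"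
      using IVT'[of H t "H t + 2 * pi" "t + 2 * pi"] by auto
    have "cis (H u) = cis (H t)" unfolding u(3) cis_eq_iff by (rule exI[of _ 1]) simp
    then have "cis u = cis t"
      using lift inj by (metis inj_onD mem_sphere_0 norm_cis)
    then obtain l :: int where l: "u = t + 2 * pi * of_int l" unfolding cis_eq_iff by blast
    have "u \<noteq> t" using u(3) by auto
    moreover have "u \<noteq> t + 2 * pi" using u(3) k \<open>2 * pi * 2 \<le> _\<close> by auto
    ultimately have "t < u" "u < t + 2 * pi" using u by linarith+
    then have "2 * pi * 0 < 2 * pi * real_of_int l" "2 * pi * real_of_int l < 2 * pi * 1"
      unfolding l by simp_all
    then have "0 < l" "l < 1" by (simp_all only: mult_less_cancel_left) auto
    then show False by simp
  qed
  ultimately have "k = 1" by simp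
  then show ?thesis using k by simp
qed

lemma periodic_lift_surj:
  assumes H: "continuous_on UNIV H" "\<And>t. H (t + 2 * pi) = H t + 2 * pi"
  shows "\<exists>t. H t = (y::real)"
proof -
  have up: "H (2 * pi * real k) = H 0 + 2 * pi * real k" for k
  proof (induction k)
    case (Suc k)
    then show ?case using H(2)[of "2 * pi * real k"] by (simp add: algebra_simps)
  qed simp
  have down: "H (- (2 * pi * real k)) = H 0 - 2 * pi * real k" for k
  proof (induction k)
    case (Suc k)
    then show ?case using H(2)[of "- (2 * pi * real (Suc k))"] by (simp add: algebra_simps)
  qed simp
  obtain k :: nat where "\<bar>y - H 0\<bar> \<le> real k" using real_arch_simple by blast
  moreover have "real k * 1 \<le> real k * (2 * pi)"
    using pi_ge_two by (intro mult_left_mono) auto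
  ultimately have "\<bar>y - H 0\<bar> \<le> 2 * pi * real k" by (simp add: algebra_simps)
  then have "H (- (2 * pi * real k)) \<le> y" "y \<le> H (2 * pi * real k)"
    unfolding up down by linarith+
  moreover have "continuous_on {- (2 * pi * real k)..2 * pi * real k} H"
    using H(1) continuous_on_subset by blast
  ultimately show ?thesis
    using IVT'[of H "- (2 * pi * real k)" y "2 * pi * real k"] by auto
qed

lemma circle_cis_in:
  assumes "z \<in> S1"
  obtains t where "a \<le> t" "t < a + 2 * pi" "z = cis t"
proof -
  obtain u where "z = cis u" using assms circle_cis by blast
  obtain k :: int where k: "0 \<le> (u - a) - 2 * pi * of_int k" "(u - a) - 2 * pi * of_int k < 2 * pi"
    using real_remainder[of "2 * pi" "u - a"] by auto
  define t where "t = u - 2 * pi * of_int k"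
  have "cis u = cis t" unfolding cis_eq_iff t_def by (rule exI[of _ k]) simp
  moreover have "a \<le> t" "t < a + 2 * pi" using k by (simp_all add: t_def)
  ultimately show thesis using that \<open>z = cis u\<close> by blast
qed

text \<open>Otherwise the line through \<open>cis a\<close> and \<open>cis \<theta>\<^sub>2\<close> would separate \<open>A\<close>.\<close>

lemma connected_circle_subset_between:
  assumes A: "connected A" "A \<subseteq> S1" and a: "cis a \<notin> A"
    and \<theta>: "a < \<theta>\<^sub>1" "\<theta>\<^sub>1 < \<theta>\<^sub>2" "\<theta>\<^sub>2 < \<theta>\<^sub>3" "\<theta>\<^sub>3 < a + 2 * pi"
    and in_A: "cis \<theta>\<^sub>1 \<in> A" "cis \<theta>\<^sub>3 \<in> A"
  shows "cis \<theta>\<^sub>2 \<in> A"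
proof (rule ccontr)
  assume not_in: "cis \<theta>\<^sub>2 \<notin> A"
  \<comment> \<open>Up to a positive factor, the signed distance from the line through
    \<open>cis a\<close> and \<open>cis \<theta>\<^sub>2\<close>.\<close>
  define G where "G z = Im ((z - cis a) * cnj (cis \<theta>\<^sub>2 - cis a))" for z
  have cis_diff: "cis x - cis y = 2 * \<i> * of_real (sin ((x - y) / 2)) * cis ((x + y) / 2)" for x y
  proof -
    have "cos x - cos y = - 2 * sin ((x - y) / 2) * sin ((x + y) / 2)"
    proof -
      have "sin ((y - x) / 2) = - sin ((x - y) / 2)"
        unfolding sin_minus[symmetric] by (rule arg_cong[of _ _ sin]) (simp add: field_simps)
      then show ?thesis unfolding cos_diff_cos by (simp only:) simp
    qed
    moreover have "sin x - sin y = 2 * sin ((x - y) / 2) * cos ((x + y) / 2)"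
      unfolding sin_diff_sin by simp
    ultimately show ?thesis by (simp add: complex_eq_iff)
  qed
  \<comment> \<open>For \<open>x\<close> strictly between \<open>a\<close> and
    \<open>a + 2 * pi\<close> the first two sines are positive, so the last one decides the
    side.\<close>
  have G: "G (cis x) = 4 * sin ((x - a) / 2) * sin ((\<theta>\<^sub>2 - a) / 2) * sin ((x - \<theta>\<^sub>2) / 2)" for x
  proof -
    have "(cis x - cis a) * cnj (cis \<theta>\<^sub>2 - cis a) =
        of_real (4 * sin ((x - a) / 2) * sin ((\<theta>\<^sub>2 - a) / 2)) *
        (cis ((x + a) / 2) * cis (- ((\<theta>\<^sub>2 + a) / 2)))"
      unfolding cis_diff by (simp add: cis_cnj algebra_simps)
    also have "cis ((x + a) / 2) * cis (- ((\<theta>\<^sub>2 + a) / 2)) = cis ((x - \<theta>\<^sub>2) / 2)"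
      unfolding cis_mult by (rule arg_cong[of _ _ cis]) (simp add: field_simps)
    finally show ?thesis by (simp add: G_def)
  qed
  have pos: "sin ((x - a) / 2) > 0" if "a < x" "x < a + 2 * pi" for x
    using that by (intro sin_gt_zero) auto
  have "sin ((\<theta>\<^sub>1 - \<theta>\<^sub>2) / 2) < 0"
    using sin_gt_zero[of "(\<theta>\<^sub>2 - \<theta>\<^sub>1) / 2"] \<theta> sin_minus[of "(\<theta>\<^sub>2 - \<theta>\<^sub>1) / 2"]
    by (simp add: minus_divide_left)
  then have "G (cis \<theta>\<^sub>1) < 0"
    unfolding G using pos \<theta> by (intro mult_pos_neg mult_pos_pos) auto
  moreover have "sin ((\<theta>\<^sub>3 - \<theta>\<^sub>2) / 2) > 0" using \<theta> by (intro sin_gt_zero) auto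
  then have "G (cis \<theta>\<^sub>3) > 0"
    unfolding G using pos \<theta> by (intro mult_pos_pos) auto
  moreover have "connected (G ` A)"
    unfolding G_def by (intro connected_continuous_image continuous_intros A)
  ultimately have "0 \<in> G ` A"
    using connectedD_interval[of "G ` A" "G (cis \<theta>\<^sub>1)" "G (cis \<theta>\<^sub>3)" 0] in_A by auto
  then obtain z where z: "z \<in> A" "G z = 0" by auto
  then obtain x where x: "a \<le> x" "x < a + 2 * pi" and zx: "z = cis x"
    using A(2) circle_cis_in[of z a] by blast
  have "x \<noteq> a" "x \<noteq> \<theta>\<^sub>2" using z(1) a not_in zx by auto
  then have "a < x" "x \<noteq> \<theta>\<^sub>2" using x by auto
  have "sin ((x - \<theta>\<^sub>2) / 2) = 0"
    using z(2) pos[of x] pos[of \<theta>\<^sub>2] \<theta> \<open>a < x\<close> x(2) by (simp add: zx G)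
  moreover have "sin ((x - \<theta>\<^sub>2) / 2) \<noteq> 0"
  proof (cases "x < \<theta>\<^sub>2")
    case True
    then show ?thesis
      using sin_gt_zero[of "(\<theta>\<^sub>2 - x) / 2"] \<theta> \<open>a < x\<close> sin_minus[of "(\<theta>\<^sub>2 - x) / 2"]
      by (simp add: minus_divide_left)
  next
    case False
    then show ?thesis
      using sin_gt_zero[of "(x - \<theta>\<^sub>2) / 2"] \<theta> \<open>a < x\<close> x(2) \<open>x \<noteq> \<theta>\<^sub>2\<close> by auto
  qed
  ultimately show False by contradiction
qed

lemma cis_interval_homeomorphic:
  assumes "a < b" "b < a + 2 * pi"
  shows "cis ` {a..b} homeomorphic {0..1::real}"
proof -
  have "inj_on cis {a..b}"
  proof (rule inj_onI)
    fix x y assume xy: "x \<in> {a..b}" "y \<in> {a..b}" "cis x = cis y"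
    then obtain k :: int where k: "x = y + 2 * pi * of_int k" unfolding cis_eq_iff by blast
    have "2 * pi * (-1) < 2 * pi * real_of_int k" "2 * pi * real_of_int k < 2 * pi * 1"
    proof -
      have "2 * pi * real_of_int k = x - y" using k by simp
      moreover have "x - y < 2 * pi" "- 2 * pi < x - y" using xy(1,2) assms by auto
      ultimately show "2 * pi * (-1) < 2 * pi * real_of_int k" "2 * pi * real_of_int k < 2 * pi * 1"
        by linarith+
    qed
    moreover have "0 < 2 * pi" by simp
    ultimately have "-1 < real_of_int k" "real_of_int k < 1"
      by (metis mult_less_cancel_left_pos)+
    then have "k = 0" by linarith
    then show "x = y" using k by simp
  qed
  then have "{a..b} homeomorphic cis ` {a..b}"
    by (intro homeomorphic_compact[OF _ _ refl] continuous_on_cis continuous_on_id) auto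
  moreover have "{a..b} homeomorphic {0..1::real}"
    using assms homeomorphic_closed_intervals_real by auto
  ultimately show ?thesis by (meson homeomorphic_sym homeomorphic_trans)
qed

section \<open>The polygon chords among the double points\<close>

context winding
begin

text \<open>The vertex with index \<open>k\<close> is passed at time \<open>20 * k\<close>, so this
  is \<open>curve_0\<close> moved along by whole periods.\<close>

lemma immersion_vertex_chord:
  "immersion (vertex n (2 * i + 1)) = immersion (vertex n (2 * i + 2 * int n))"
proof -
  have sp: "speed * (pi * of_int k / real (2 * n + 1)) = 20 * of_int k" for k
    by (simp add: speed_def del: of_nat_Suc of_nat_add)
  have "curve (20 * of_int (2 * i + 2 * int n)) = curve (0 + 40 * of_int (i + int n))"
    by (simp add: algebra_simps)
  also have "\<dots> = curve 0 + 144 * of_int (i + int n)" by (rule curve_shift)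
  also have "\<dots> = (curve 20 + 144 * of_int i) + 72 * of_int (int (2 * n + 1) * 1)"
    unfolding curve_0 by (simp add: algebra_simps)
  also have "curve 20 + 144 * of_int i = curve (20 * of_int (2 * i + 1))"
    unfolding curve_shift[symmetric] by (simp add: algebra_simps)
  finally have "lift (pi * of_int (2 * i + 2 * int n) / real (2 * n + 1)) = lift (pi * of_int (2 * i + 1) / real (2 * n + 1))"
    unfolding lift_eq_iff sp by blast
  then show ?thesis unfolding vertex_def immersion_cis by simp
qed

lemma vertex_chord_nontrivial: "vertex n (2 * i + 1) \<noteq> vertex n (2 * i + 2 * int n)"
proof
  assume "vertex n (2 * i + 1) = vertex n (2 * i + 2 * int n)"
  then have "int (4 * n + 2) dvd 2 * i + 1 - (2 * i + 2 * int n)" unfolding vertex_eq_iff .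
  moreover have "2 dvd int (4 * n + 2)" by simp
  ultimately have "2 dvd 2 * i + 1 - (2 * i + 2 * int n)" by (rule dvd_trans[rotated])
  then show False by presburger
qed

lemma vertex_in_S1: "vertex m k \<in> S1"
  by (simp add: vertex_def)

text \<open>The absence of triple points makes the partner of \<open>x\<close> unique.\<close>

lemma associated_involution:
  assumes "x \<in> S1" "y \<in> S1" "x \<noteq> y" "immersion x = immersion y"
  shows "x \<in> multiple_points immersion" "snd (associated_diagram immersion) x = y"
proof -
  have mp: "x \<in> multiple_points immersion" "y \<in> multiple_points immersion"
    unfolding multiple_points_iff using assms by auto
  then show "x \<in> multiple_points immersion" by simp
  have "z = y" if "z \<in> multiple_points immersion \<and> z \<noteq> x \<and> immersion z = immersion x" for z
    using that assms immersion_triple[of z x y] by (auto simp: multiple_points_iff)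
  then show "snd (associated_diagram immersion) x = y"
    unfolding associated_diagram_def snd_conv using mp assms by (intro the_equality) auto
qed

lemma associated_vertex:
  "vertex n k \<in> multiple_points immersion"
  "snd (associated_diagram immersion) (vertex n k) = snd (odd_polygon_diagram n) (vertex n k)"
  "snd (odd_polygon_diagram n) (vertex n k) \<in> range (vertex n)"
proof -
  have "vertex n k \<in> multiple_points immersion \<and>
    snd (associated_diagram immersion) (vertex n k) = snd (odd_polygon_diagram n) (vertex n k) \<and>
    snd (odd_polygon_diagram n) (vertex n k) \<in> range (vertex n)"
  proof (cases "even k")
    case True
    then obtain j where "k = 2 * j" by (elim evenE)
    then have "k = 2 * (j - int n) + 2 * int n" by simp
    then obtain i where k: "k = 2 * i + 2 * int n" by blast
    show ?thesis
      using associated_involution[OF vertex_in_S1 vertex_in_S1 vertex_chord_nontrivial[symmetric, of i]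
          immersion_vertex_chord[symmetric]]
      unfolding k polygon_diagram_involution[OF n_pos] by auto
  next
    case False
    then obtain i where k: "k = 2 * i + 1" using oddE by blast
    show ?thesis
      using associated_involution[OF vertex_in_S1 vertex_in_S1 vertex_chord_nontrivial[of i]
          immersion_vertex_chord]
      unfolding k polygon_diagram_involution[OF n_pos] by auto
  qed
  then show "vertex n k \<in> multiple_points immersion"
    "snd (associated_diagram immersion) (vertex n k) = snd (odd_polygon_diagram n) (vertex n k)"
    "snd (odd_polygon_diagram n) (vertex n k) \<in> range (vertex n)" by auto
qed

lemma card_vertices: "finite (range (vertex m))" "card (range (vertex m)) = 4 * m + 2"
proof -
  let ?N = "int (4 * m + 2)"
  have "vertex m k \<in> vertex m ` {0..<?N}" for k
  proof -
    have "vertex m k = vertex m (k mod ?N)" unfolding vertex_eq_iff by (simp add: mod_eq_dvd_iff[symmetric])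
    moreover have "k mod ?N \<in> {0..<?N}" by simp
    ultimately show ?thesis by blast
  qed
  then have r: "range (vertex m) = vertex m ` {0..<?N}" by blast
  then show "finite (range (vertex m))" by simp
  have "inj_on (vertex m) {0..<?N}"
  proof (rule inj_onI)
    fix a b assume ab: "a \<in> {0..<?N}" "b \<in> {0..<?N}" "vertex m a = vertex m b"
    then have "?N dvd a - b" by (simp only: vertex_eq_iff)
    then show "a = b" using ab(1,2) by (metis atLeastLessThan_iff mod_eq_dvd_iff mod_pos_pos_trivial)
  qed
  then show "card (range (vertex m)) = 4 * m + 2" unfolding r by (simp add: card_image)
qed

text \<open>The polygon vertices themselves span the sub-diagram, so the identity serves as the
  equivalence.\<close>

lemma contains_odd_polygon: "has_sub_equivalent_to (associated_diagram immersion) (odd_polygon_diagram n)"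
proof -
  define \<phi> where "\<phi> = snd (odd_polygon_diagram n)"
  have D: "odd_polygon_diagram n = (range (vertex n), \<phi>)"
    unfolding \<phi>_def polygon_diagram_points[OF n_pos, symmetric] by (rule prod.collapse[symmetric])
  have A: "associated_diagram immersion = (multiple_points immersion, snd (associated_diagram immersion))"
    unfolding associated_diagram_def snd_conv by (rule refl)
  have inv: "\<phi> x \<in> range (vertex n) \<and> \<phi> x \<noteq> x \<and> \<phi> (\<phi> x) = x" if "x \<in> range (vertex n)" for x
  proof -
    from that obtain k where x: "x = vertex n k" by blast
    show ?thesis
    proof (cases "even k")
      case True
      then obtain j where "k = 2 * j" by (elim evenE)
      then have "k = 2 * (j - int n) + 2 * int n" by simp
    then obtain i where k: "k = 2 * i + 2 * int n" by blast
      show ?thesis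
        unfolding x k \<phi>_def polygon_diagram_involution[OF n_pos] using vertex_chord_nontrivial[of i] by auto
    next
      case False
      then obtain i where k: "k = 2 * i + 1" using oddE by blast
      show ?thesis
        unfolding x k \<phi>_def polygon_diagram_involution[OF n_pos] using vertex_chord_nontrivial[of i] by auto
    qed
  qed
  have "chord_diagram (2 * n + 1) (range (vertex n), \<phi>)"
    unfolding chord_diagram_def prod.case
  proof (intro conjI ballI)
    show "range (vertex n) \<subseteq> S1" using vertex_in_S1 by blast
    show "card (range (vertex n)) = 2 * (2 * n + 1)" using card_vertices(2)[of n] by simp
    show "\<phi> x \<in> range (vertex n)" "\<phi> x \<noteq> x" "\<phi> (\<phi> x) = x" if "x \<in> range (vertex n)" for x
      using inv[OF that] by blast+
  qed (use card_vertices(1) in simp_all)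
  moreover have "range (vertex n) \<subseteq> multiple_points immersion" using associated_vertex(1) by blast
  moreover have "\<forall>x\<in>range (vertex n). \<phi> x = snd (associated_diagram immersion) x"
  proof
    fix x assume "x \<in> range (vertex n)"
    then obtain k where x: "x = vertex n k" by (rule rangeE)
    show "\<phi> x = snd (associated_diagram immersion) x"
      unfolding x \<phi>_def by (rule associated_vertex(2)[symmetric])
  qed
  ultimately have "sub_chord_diagram (range (vertex n), \<phi>) (associated_diagram immersion)"
    by (subst A) (unfold sub_chord_diagram_def prod.case, intro conjI exI)
  moreover have "orientation_preserving_homeo (\<lambda>x. x)"
    unfolding orientation_preserving_homeo_def
  proof (intro conjI exI allI)
    show "homeomorphism S1 S1 (\<lambda>x. x) (\<lambda>x. x)" by (rule homeomorphism_ident)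
    show "continuous_on UNIV (\<lambda>x::real. x)" by (rule continuous_on_id)
    show "strict_mono (\<lambda>x::real. x)" by (simp add: strict_mono_def)
  qed (rule refl)
  then have "equivalent_diagrams (range (vertex n), \<phi>) (odd_polygon_diagram n)"
    unfolding D equivalent_diagrams_def prod.case by (intro exI[of _ "\<lambda>x. x"]) simp
  ultimately show ?thesis unfolding has_sub_equivalent_to_def by blast
qed

section \<open>Counting blocks along a copy of an odd polygon diagram\<close>

definition block :: "real \<Rightarrow> int" where
  "block t = \<lfloor>(speed * t + 13) / 40\<rfloor>"

lemma block_mono: "s \<le> t \<Longrightarrow> block s \<le> block t"
  using speed_pos unfolding block_def by (intro floor_mono divide_right_mono add_right_mono mult_left_mono) auto

lemma block_period: "block (t + 2 * pi * of_int k) = block t + int (2 * n + 1) * k"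
proof -
  have "(speed * (t + 2 * pi * of_int k) + 13) / 40 = (speed * t + 13) / 40 + of_int (int (2 * n + 1) * k)"
    unfolding speed_period by (simp add: field_simps)
  then show ?thesis unfolding block_def by (simp only: floor_add_int)
qed

lemma block_step:
  assumes "lift s = lift t" "s < t" "t < s + 2 * pi"
  shows "block s + int n \<le> block t"
proof -
  obtain p q :: int where pq: "40 * of_int p < speed * s + 13" "speed * s + 13 < 40 * (of_int p + 1)"
    "40 * of_int q < speed * t + 13" "speed * t + 13 < 40 * (of_int q + 1)"
    "q = p + int n \<or> q = p + int n + 1"
    using lift_eq_blocks[OF assms] by metis
  have "block s = p" "block t = q"
    unfolding block_def using pq by (auto intro!: floor_unique simp: field_simps)
  then show ?thesis using pq(5) by auto
qed

lemma no_smaller_odd_polygon: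
  assumes "m \<ge> 1" "has_sub_equivalent_to (associated_diagram immersion) (odd_polygon_diagram m)"
  shows "n \<le> m"
proof -
  obtain Q \<psi> where sub: "sub_chord_diagram (Q, \<psi>) (associated_diagram immersion)"
    and eq: "equivalent_diagrams (Q, \<psi>) (odd_polygon_diagram m)"
    using assms(2) unfolding has_sub_equivalent_to_def by auto
  have Q: "Q \<subseteq> S1" "Q \<subseteq> multiple_points immersion"
    "\<And>x. x \<in> Q \<Longrightarrow> \<psi> x \<in> Q" "\<And>x. x \<in> Q \<Longrightarrow> \<psi> x = snd (associated_diagram immersion) x"
    using sub unfolding sub_chord_diagram_def associated_diagram_def chord_diagram_def by auto
  have "odd_polygon_diagram m = (range (vertex m), snd (odd_polygon_diagram m))"
    unfolding polygon_diagram_points[OF assms(1), symmetric] by simp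
  with eq obtain h where h: "orientation_preserving_homeo h" "h ` Q = range (vertex m)"
    "\<And>x. x \<in> Q \<Longrightarrow> h (\<psi> x) = snd (odd_polygon_diagram m) (h x)"
    unfolding equivalent_diagrams_def by (auto split: prod.splits)
  then obtain g H where gH: "homeomorphism S1 S1 h g" "continuous_on UNIV H" "strict_mono H"
    "\<And>t. h (cis t) = cis (H t)"
    unfolding orientation_preserving_homeo_def by blast
  have H_period: "H (t + 2 * pi) = H t + 2 * pi" for t
    by (rule orientation_preserving_lift_period[OF gH])
  have h_inj: "x = y" if "x \<in> S1" "y \<in> S1" "h x = h y" for x y
    using that gH(1) by (metis homeomorphism_apply1)
  have "\<forall>k::int. \<exists>t. H t = pi * of_int k / real (2 * m + 1)"
    using periodic_lift_surj[OF gH(2) H_period] by blast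
  \<comment> \<open>The \<open>q k\<close> are the angles, in increasing order, of the endpoints
    that \<open>h\<close> sends to the polygon vertices.\<close>
  then obtain q :: "int \<Rightarrow> real" where q: "\<And>k. H (q k) = pi * of_int k / real (2 * m + 1)"
    by metis
  have q_mono: "q a < q b" if "a < b" for a b
  proof -
    have "H (q a) < H (q b)"
      unfolding q using that by (intro divide_strict_right_mono mult_strict_left_mono) auto
    then show ?thesis using gH(3) by (simp add: strict_mono_less)
  qed
  have q_period: "q (k + int (4 * m + 2)) = q k + 2 * pi" for k
  proof -
    have "H (q (k + int (4 * m + 2))) = H (q k + 2 * pi)"
      unfolding H_period q by (simp add: field_simps)
    then show ?thesis using gH(3) by (simp add: strict_mono_eq)
  qed
  have q_periods: "q (k + int (4 * m + 2) * int j) = q k + 2 * pi * of_int (int j)" for k j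
  proof (induction j)
    case (Suc j)
    then show ?case using q_period[of "k + int (4 * m + 2) * int j"] by (simp add: algebra_simps)
  qed simp
  have vertex_q: "h (cis (q k)) = vertex m k" for k
    unfolding gH(4) q vertex_def ..
  have chord: "lift (q (2 * i + 1)) = lift (q (2 * i + 2 * int m))" for i
  proof -
    define x where "x = cis (q (2 * i + 1))"
    have "h x \<in> h ` Q" unfolding x_def vertex_q h(2) by simp
    then obtain x' where "x' \<in> Q" "h x' = h x" by auto
    moreover have "x \<in> S1" by (simp add: x_def)
    ultimately have x: "x \<in> Q" using h_inj Q(1) by blast
    have "h (\<psi> x) = h (cis (q (2 * i + 2 * int m)))"
      unfolding h(3)[OF x] vertex_q
      unfolding x_def vertex_q by (rule polygon_diagram_involution[OF assms(1)])
    then have "\<psi> x = cis (q (2 * i + 2 * int m))"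
      using h_inj Q(1) Q(3)[OF x] by (metis mem_sphere_0 norm_cis subsetD)
    moreover obtain y where "y \<in> S1" "y \<noteq> x" "immersion y = immersion x"
      using x Q(2) multiple_points_iff by blast
    then have "\<psi> x = y" using associated_involution(2)[of x y] \<open>x \<in> S1\<close> Q(4)[OF x] by simp
    ultimately show ?thesis
      using \<open>immersion y = immersion x\<close> immersion_cis unfolding x_def by metis
  qed
  \<comment> \<open>The chord from \<open>q (2 * i + 1)\<close> ends just before the start of the
    chord with index \<open>i + m\<close>, so chords can be chained without overlap.\<close>
  have step: "block (q (2 * i + 1)) + int n \<le> block (q (2 * (i + int m) + 1))" for i
  proof -
    have "q (2 * i + 1) < q (2 * i + 2 * int m)" using assms(1) by (intro q_mono) auto
    moreover have "q (2 * i + 2 * int m) < q (2 * i + 1 + int (4 * m + 2))" by (intro q_mono) auto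
    then have "q (2 * i + 2 * int m) < q (2 * i + 1) + 2 * pi" unfolding q_period .
    ultimately have "block (q (2 * i + 1)) + int n \<le> block (q (2 * i + 2 * int m))"
      using block_step[OF chord] by blast
    also have "\<dots> \<le> block (q (2 * (i + int m) + 1))"
      by (intro block_mono less_imp_le q_mono) simp
    finally show ?thesis .
  qed
  have steps: "block (q 1) + int j * int n \<le> block (q (2 * (int j * int m) + 1))" for j
  proof (induction j)
    case (Suc j)
    then show ?case using step[of "int j * int m"] by (simp add: algebra_simps)
  qed simp
  \<comment> \<open>After \<open>2 * m + 1\<close> chords the index has grown by \<open>m\<close>
    times the number of vertices: the chain closes up after \<open>m\<close> turns, each of
    \<open>2 * n + 1\<close> blocks.\<close>
  have "2 * (int (2 * m + 1) * int m) + 1 = 1 + int (4 * m + 2) * int m" by (simp add: algebra_simps)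
  then have "q (2 * (int (2 * m + 1) * int m) + 1) = q 1 + 2 * pi * of_int (int m)"
    by (simp only: q_periods)
  then have "block (q 1) + int (2 * m + 1) * int n \<le> block (q 1) + int (2 * n + 1) * int m"
    using steps[of "2 * m + 1"] by (simp only: block_period)
  then show "n \<le> m" by (simp add: algebra_simps)
qed

section \<open>The arc number\<close>

lemma inj_on_blocks:
  assumes "a = (40 * of_int i - 13) / speed" "b = (40 * of_int (i + int n) - 13) / speed"
  shows "inj_on immersion (cis ` {a..b})"
proof -
  have sa: "speed * a = 40 * of_int i - 13" and sb: "speed * b = 40 * of_int (i + int n) - 13"
    using speed_pos assms by auto
  have "speed * (a + 2 * pi * of_int 1) = speed * a + 40 * of_int (int (2 * n + 1) * 1)" by (rule speed_period)
  then have "speed * b < speed * (a + 2 * pi)" unfolding sa sb by simp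
  then have ab: "b < a + 2 * pi" using speed_pos by simp
  have main: False if "s \<in> {a..b}" "t \<in> {a..b}" "lift s = lift t" "s < t" for s t
  proof -
    have "t < s + 2 * pi" using that ab by auto
    from lift_eq_blocks[OF that(3,4) this] obtain p q :: int where
      pq: "speed * s + 13 < 40 * (of_int p + 1)" "40 * of_int q < speed * t + 13"
      "q = p + int n \<or> q = p + int n + 1" by metis
    have "speed * a \<le> speed * s" "speed * t \<le> speed * b" using that speed_pos by auto
    \<comment> \<open>Double points avoid the block boundaries, so \<open>p\<close> and
      \<open>q\<close> both lie among the \<open>n\<close> indices starting at \<open>i\<close>, too
      close together for a chord.\<close>
    then have "real_of_int i < of_int p + 1" "real_of_int q < of_int (i + int n)"
      using pq sa sb by auto
    then have "i \<le> p" "q < i + int n" by linarith+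
    then show False using pq(3) by auto
  qed
  show ?thesis
  proof (rule inj_onI)
    fix x y assume "x \<in> cis ` {a..b}" "y \<in> cis ` {a..b}" "immersion x = immersion y"
    then obtain s t where "x = cis s" "y = cis t" "s \<in> {a..b}" "t \<in> {a..b}" "lift s = lift t"
      by (auto simp: immersion_cis)
    then show "x = y" using main[of s t] main[of t s] by (cases s t rule: linorder_cases) auto
  qed
qed

lemma divisible_3: "divisible_into_arcs immersion 3"
proof -
  define e where "e j = (40 * of_int (int j) - 13) / speed" for j
  \<comment> \<open>The cuts produce arcs of \<open>n\<close>, \<open>n\<close> and 1
    blocks.\<close>
  define c where "c i = (if i = 1 then 0 else if i = 2 then n else if i = 3 then 2 * n else 2 * n + 1)" for i :: nat
  define I where "I i = cis ` {e (c i)..e (c (i + 1))}" for i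
  have e_mono: "e j < e k" if "j < k" for j k
    using that speed_pos unfolding e_def by (intro divide_strict_right_mono) auto
  have e_2pi: "e (2 * n + 1) = e 0 + 2 * pi"
    using speed_pos speed_period[of "e 0" 1] unfolding e_def by (simp add: field_simps speed_def)
  have I: "I i homeomorphic {0..1::real} \<and> inj_on immersion (I i)" if "i \<in> {1..3}" for i
  proof
    have "i = 1 \<or> i = 2 \<or> i = 3" using that by auto
    then have c: "c i < c (i + 1)" "c (i + 1) \<le> c i + n" "c (i + 1) - c i < 2 * n + 1" "c (i + 1) \<le> 2 * n + 1"
      using n_pos by (auto simp: c_def)
    have "e (c (i + 1)) \<le> e (2 * n + 1)" "e 0 \<le> e (c i)" "c (i + 1) < 2 * n + 1 \<or> 0 < c i"
      using c e_mono by (metis le_neq_implies_less less_imp_le order_refl, metis le_neq_implies_less less_imp_le order_refl zero_le, linarith)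
    then have "e (c (i + 1)) < e (c i) + 2 * pi"
      using e_2pi e_mono[of "c (i + 1)" "2 * n + 1"] e_mono[of 0 "c i"] by linarith
    then show "I i homeomorphic {0..1::real}"
      unfolding I_def using e_mono[OF c(1)] by (intro cis_interval_homeomorphic)
    have "inj_on immersion (cis ` {e (c i)..e (c i + n)})"
      by (rule inj_on_blocks[where i = "int (c i)"]) (simp_all add: e_def)
    moreover have "e (c (i + 1)) \<le> e (c i + n)"
      using c(2) e_mono by (metis le_neq_implies_less less_imp_le order_refl)
    then have "cis ` {e (c i)..e (c (i + 1))} \<subseteq> cis ` {e (c i)..e (c i + n)}"
      by (intro image_mono) auto
    ultimately show "inj_on immersion (I i)"
      unfolding I_def by (rule inj_on_subset)
  qed
  have "S1 = (\<Union>i\<in>{1..3}. I i)"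
  proof (intro equalityI subsetI)
    fix z assume "z \<in> S1"
    then obtain t where t: "e 0 \<le> t" "t < e 0 + 2 * pi" "z = cis t" using circle_cis_in by blast
    then consider "t \<in> {e 0..e n}" | "t \<in> {e n..e (2 * n)}" | "t \<in> {e (2 * n)..e (2 * n + 1)}"
      using e_2pi by force
    then show "z \<in> (\<Union>i\<in>{1..3}. I i)"
    proof cases
      case 1 then show ?thesis using t(3) by (intro UN_I[of 1]) (auto simp: I_def c_def)
    next
      case 2 then show ?thesis using t(3) by (intro UN_I[of 2]) (auto simp: I_def c_def)
    next
      case 3 then show ?thesis using t(3) by (intro UN_I[of 3]) (auto simp: I_def c_def)
    qed
  qed (auto simp: I_def)
  then show ?thesis unfolding divisible_into_arcs_def using I by blast
qed

text \<open>Among \<open>2 * n + 1\<close> consecutive vertices there are both ends of a chord,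
  which spans only \<open>2 * n\<close> of them.\<close>

lemma run_not_injective:
  assumes "inj_on immersion A" "\<And>j. k \<le> j \<Longrightarrow> j \<le> k + 2 * int n \<Longrightarrow> vertex n j \<in> A"
  shows False
proof -
  define i where "i = k div 2"
  have i: "k \<le> 2 * i + 1" "2 * i \<le> k" unfolding i_def by presburger+
  have "vertex n (2 * i + 1) \<in> A" "vertex n (2 * i + 2 * int n) \<in> A"
    using i n_pos by (auto intro!: assms(2))
  then show False
    using assms(1) immersion_vertex_chord vertex_chord_nontrivial by (metis inj_onD)
qed

lemma vertex_period: "vertex m (k + int (4 * m + 2)) = vertex m k"
  unfolding vertex_eq_iff by simp

text \<open>The first arc misses some vertex \<open>k\<close>, and by connectedness its vertices
  form one run \<open>l\<close>, ..., \<open>r\<close> in the cyclic order cut at \<open>k\<close>.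
  Either this run or the complementary one has at least \<open>2 * n + 1\<close> vertices.\<close>

lemma not_divisible_2: "\<not> divisible_into_arcs immersion 2"
proof
  assume "divisible_into_arcs immersion 2"
  then obtain I :: "nat \<Rightarrow> complex set" where
    I: "\<forall>i\<in>{1..2}. I i homeomorphic {0..1::real} \<and> inj_on immersion (I i)" "S1 = (\<Union>i\<in>{1..2}. I i)"
    unfolding divisible_into_arcs_def by blast
  define A B where "A = I 1" and "B = I 2"
  have AB: "inj_on immersion A" "inj_on immersion B" "S1 = A \<union> B" "A homeomorphic {0..1::real}"
    using I by (auto simp: A_def B_def numeral_2_eq_2 atLeastAtMostSuc_conv)
  have conn: "connected A" using AB(4) homeomorphic_connectedness by (metis connected_Icc)
  have in_B: "vertex n j \<in> B" if "vertex n j \<notin> A" for j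
    using that AB(3) vertex_in_S1 by blast
  obtain k where k: "vertex n k \<notin> A" using run_not_injective[OF AB(1)] by blast
  have between: "vertex n b \<in> A"
    if "k < a" "a \<le> b" "b \<le> c" "c < k + int (4 * n + 2)" "vertex n a \<in> A" "vertex n c \<in> A" for a b c
  proof (cases "a = b \<or> b = c")
    case False
    have less: "pi * real_of_int x / real (2 * n + 1) < pi * real_of_int y / real (2 * n + 1)" if "x < y" for x y
      using that by (intro divide_strict_right_mono mult_strict_left_mono) auto
    have per: "pi * real_of_int (k + int (4 * n + 2)) / real (2 * n + 1) = pi * real_of_int k / real (2 * n + 1) + 2 * pi"
      by (simp add: field_simps)
    show ?thesis
      using connected_circle_subset_between[OF conn _ k[unfolded vertex_def], of "pi * of_int a / real (2 * n + 1)"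
          "pi * of_int b / real (2 * n + 1)" "pi * of_int c / real (2 * n + 1)"]
        that False AB(3) less[of k a] less[of a b] less[of b c] less[OF that(4)] per
      unfolding vertex_def by auto
  qed (use that in auto)
  define J where "J = {j \<in> {k<..<k + int (4 * n + 2)}. vertex n j \<in> A}"
  have "finite J" unfolding J_def by (rule finite_subset[of _ "{k<..<k + int (4 * n + 2)}"]) auto
  show False
  proof (cases "J = {}")
    case True
    have "vertex n j \<in> B" if "k + 1 \<le> j" "j \<le> k + 1 + 2 * int n" for j
      using True that n_pos by (intro in_B) (auto simp: J_def)
    then show False using run_not_injective[OF AB(2)] by blast
  next
    case False
    define l r where "l = Min J" and "r = Max J"
    have lr: "l \<in> J" "r \<in> J" "\<And>j. j \<in> J \<Longrightarrow> l \<le> j \<and> j \<le> r"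
      using False \<open>finite J\<close> by (auto simp: l_def r_def)
    show False
    proof (cases "l + 2 * int n \<le> r")
      case True
      have "vertex n j \<in> A" if "l \<le> j" "j \<le> l + 2 * int n" for j
        using that True lr(1,2) by (intro between[of l j r]) (auto simp: J_def)
      then show False using run_not_injective[OF AB(1)] by blast
    next
      case False
      have "vertex n j \<in> B" if j: "r + 1 \<le> j" "j \<le> r + 1 + 2 * int n" for j
      proof (rule in_B)
        \<comment> \<open>The run after \<open>r\<close> may pass \<open>k\<close> and continue with
          the vertices after it; being shorter than a turn minus the run of \<open>A\<close>, it
          stops before reaching \<open>l\<close> again.\<close>
        consider "j < k + int (4 * n + 2)" | "j = k + int (4 * n + 2)" | "k + int (4 * n + 2) < j" by linarith
        then show "vertex n j \<notin> A"
        proof cases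
          case 1 then show ?thesis using j lr(2) lr(3)[of j] by (auto simp: J_def)
        next
          case 2 then show ?thesis using k vertex_period by metis
        next
          case 3
          define i where "i = j - int (4 * n + 2)"
          have "vertex n j = vertex n i" using vertex_period[of n i] by (simp add: i_def)
          moreover have "k < i" "i < l" using 3 j False by (simp_all add: i_def)
          then have "i \<notin> J" "i < k + int (4 * n + 2)" using lr(3)[of i] lr(1) by (auto simp: J_def)
          then have "vertex n i \<notin> A" using \<open>k < i\<close> by (simp add: J_def)
          ultimately show ?thesis by simp
        qed
      qed
      then show False using run_not_injective[OF AB(2)] by blast
    qed
  qed
qed

lemma arc_number_immersion: "arc_number immersion = 3"
proof -
  have "\<not> inj_on immersion S1"
    using run_not_injective[of S1 0] vertex_in_S1 by blast
  moreover have "(LEAST k. k > 1 \<and> divisible_into_arcs immersion k) = 3"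
  proof (rule Least_equality)
    fix k assume "k > 1 \<and> divisible_into_arcs immersion k"
    then have "k > 1" "k \<noteq> 2" using not_divisible_2 by auto
    then show "3 \<le> k" by linarith
  qed (simp add: divisible_3)
  moreover have "\<exists>k>1. divisible_into_arcs immersion k"
    using divisible_3 by (intro exI[of _ 3]) simp
  ultimately show ?thesis by (simp add: arc_number_def numeral_eq_enat)
qed

end

theorem proposition1p2:
  fixes n :: nat
  assumes "n \<ge> 1"
  shows "\<exists>f :: complex \<Rightarrow> complex.
           smooth_immersion f \<and>
           arc_number f = 3 \<and>
           finitely_many_double_points f \<and>
           transversal_multiple_points f \<and>
           has_sub_equivalent_to (associated_diagram f) (odd_polygon_diagram n) \<and>
           (\<forall>m. 1 \<le> m \<and> m < n \<longrightarrow>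
              \<not> has_sub_equivalent_to (associated_diagram f) (odd_polygon_diagram m))"
proof -
  interpret winding n by standard (fact assms)
  show ?thesis
    using smooth_immersion_immersion arc_number_immersion finitely_many_double_points_immersion
      transversal_immersion contains_odd_polygon no_smaller_odd_polygon
    by (intro exI[of _ immersion]) (metis not_le)
qed

end
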